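(* Given $f_1,\dots,f_k\in D[x]$, let $\mathbf f\colon\widehat D\to\widehat D^k$ be the map $a\mapsto(f_1(a),\dots,f_k(a))$. If $X\subseteq\widehat D^k$ is openly Eulerian, with closure $\widehat X$, then the procounting distribution $\mu_{\mathbf f^{-1}(\widehat X)}$ exists.
   Context: $F$ is a global field, $\mathcal S$ a nonempty finite set of places of $F$ containing the archimedean ones, $D$ the ring of $\mathcal S$-integers of $F$. $\widehat D=\varprojlim D/\mathfrak a$ over non-zero ideals $\mathfrak a$, and $\widehat D_{\mathfrak p}=\varprojlim D/\mathfrak p^j$ for each non-zero prime $\mathfrak p$, so that $\widehat D=\prod_{\mathfrak p}\widehat D_{\mathfrak p}$; $\widehat\pi_{\mathfrak a}\colon\widehat D\to D/\mathfrak a$ and $\widehat\pi_{\mathfrak p^\infty}\colon\widehat D^k\to\widehat D_{\mathfrak p}^k$ are the projections and $\mu_{\widehat D}$ is the normalized Haar measure. For $X\subseteq\widehat D^k$, $\widehat X$ is its closure and $X(\mathfrak p)$ is the closure of $\widehat\pi_{\mathfrak p^\infty}(X)$ in $\widehat D_{\mathfrak p}^k$. $X$ is Eulerian if $\widehat X=\prod_{\mathfrak p}X(\mathfrak p)$, and openly Eulerian if moreover every $X(\mathfrak p)$ is open. For nonempty $S\subseteq\widehat D$ let $\widetilde\mu_{S,\mathfrak a}:=\frac{|D/\mathfrak a|}{|\widehat\pi_{\mathfrak a}(S)|}\mathbf 1_{\widehat\pi_{\mathfrak a}^{-1}(\widehat\pi_{\mathfrak a}(S))}\cdot\mu_{\widehat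 D}$, and $\widetilde\mu_{\emptyset,\mathfrak a}:=0$. The procounting distribution is $\mu_S:=\lim_{\mathfrak a\to0}\widetilde\mu_{S,\mathfrak a}$ (if it exists), the net being indexed by non-zero ideals ordered by divisibility and the limit being in the weak-* sense (convergence of $\widetilde\mu_{S,\mathfrak a}(\mathbf 1_U)$ for every compact open $U\subseteq\widehat D$). *)

theory Defs
  imports "HOL-Analysis.Analysis" "HOL-Algebra.Algebra" "HOL-Algebra.UnivPoly"
    "HOL-Algebra.Algebraic_Closure_Type"
begin

section \<open>Global fields, places and S-integers\<close>

definition number_field :: "('a, 'm) ring_scheme \<Rightarrow> bool" where
  "number_field F \<longleftrightarrow> field F \<and>
     (\<exists>K. subfield K F \<and> F\<lparr>carrier := K\<rparr> \<simeq> (ring_of_type_algebra :: rat ring) \<and>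
          ring.finite_dimension F K (carrier F))"

text \<open>A global function field is a finite extension of \<open>k(t)\<close> with \<open>k\<close> a finite field and \<open>t\<close>
  transcendental over \<open>k\<close>.\<close>

definition global_function_field :: "('a, 'm) ring_scheme \<Rightarrow> bool" where
  "global_function_field F \<longleftrightarrow> field F \<and>
     (\<exists>k t. subfield k F \<and> finite k \<and> t \<in> carrier F \<and> ring.transcendental F k t \<and>
          ring.finite_dimension F (generate_field F (insert t k)) (carrier F))"

definition global_field :: "('a, 'm) ring_scheme \<Rightarrow> bool" where
  "global_field F \<longleftrightarrow> number_field F \<or> global_function_field F"

definition nontrivial_absolute_value :: "('a, 'm) ring_scheme \<Rightarrow> ('a \<Rightarrow> real) \<Rightarrow> bool" where
  "nontrivial_absolute_value F v \<longleftrightarrow>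
     (\<forall>x\<in>carrier F. 0 \<le> v x) \<and>
     (\<forall>x\<in>carrier F. v x = 0 \<longleftrightarrow> x = \<zero>\<^bsub>F\<^esub>) \<and>
     (\<forall>x\<in>carrier F. \<forall>y\<in>carrier F. v (x \<otimes>\<^bsub>F\<^esub> y) = v x * v y) \<and>
     (\<forall>x\<in>carrier F. \<forall>y\<in>carrier F. v (x \<oplus>\<^bsub>F\<^esub> y) \<le> v x + v y) \<and>
     (\<exists>x\<in>carrier F. x \<noteq> \<zero>\<^bsub>F\<^esub> \<and> v x \<noteq> 1)"

definition absolute_value_equiv :: "('a, 'm) ring_scheme \<Rightarrow> (('a \<Rightarrow> real) \<times> ('a \<Rightarrow> real)) set" where
  "absolute_value_equiv F =
     {(v, w). nontrivial_absolute_value F v \<and> nontrivial_absolute_value F w \<and>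
              (\<exists>s>0. \<forall>x\<in>carrier F. w x = v x powr s)}"

text \<open>The values of \<open>v\<close> outside \<open>carrier F\<close> are irrelevant: functions that agree on the carrier
  lie in the same class.\<close>

definition places :: "('a, 'm) ring_scheme \<Rightarrow> ('a \<Rightarrow> real) set set" where
  "places F = {v. nontrivial_absolute_value F v} // absolute_value_equiv F"

definition archimedean_places :: "('a, 'm) ring_scheme \<Rightarrow> ('a \<Rightarrow> real) set set" where
  "archimedean_places F =
     {P \<in> places F. \<forall>v\<in>P. \<not> (\<forall>x\<in>carrier F. \<forall>y\<in>carrier F. v (x \<oplus>\<^bsub>F\<^esub> y) \<le> max (v x) (v y))}"

definition S_integers :: "('a, 'm) ring_scheme \<Rightarrow> ('a \<Rightarrow> real) set set \<Rightarrow> ('a, 'm) ring_scheme" where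
  "S_integers F S = F\<lparr>carrier := {x \<in> carrier F. \<forall>P\<in>places F - S. \<forall>v\<in>P. v x \<le> 1}\<rparr>"


section \<open>Completions\<close>

text \<open>The inverse limit of the rings \<open>R Quot \<aa> i\<close>. If \<open>\<aa> i \<subseteq> \<aa> j\<close>, the transition map sends the
  coset \<open>\<aa> i +> r\<close> to \<open>\<aa> j +> r\<close>, which is the set sum of \<open>\<aa> j\<close> and \<open>\<aa> i +> r\<close>.\<close>

definition quot_limit :: "('a, 'm) ring_scheme \<Rightarrow> 'i set \<Rightarrow> ('i \<Rightarrow> 'a set) \<Rightarrow> ('i \<Rightarrow> 'a set) ring" where
  "quot_limit R I \<aa> =
     \<lparr>carrier = {x \<in> (\<Pi>\<^sub>E i\<in>I. carrier (R Quot \<aa> i)).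
                   \<forall>i\<in>I. \<forall>j\<in>I. \<aa> i \<subseteq> \<aa> j \<longrightarrow> x j = \<aa> j <+>\<^bsub>R\<^esub> x i},
      monoid.mult = (\<lambda>x y. \<lambda>i\<in>I. x i \<otimes>\<^bsub>R Quot \<aa> i\<^esub> y i),
      monoid.one = (\<lambda>i\<in>I. \<one>\<^bsub>R Quot \<aa> i\<^esub>),
      ring.zero = (\<lambda>i\<in>I. \<zero>\<^bsub>R Quot \<aa> i\<^esub>),
      ring.add = (\<lambda>x y. \<lambda>i\<in>I. x i \<oplus>\<^bsub>R Quot \<aa> i\<^esub> y i)\<rparr>"

definition quot_limit_topology ::
    "('a, 'm) ring_scheme \<Rightarrow> 'i set \<Rightarrow> ('i \<Rightarrow> 'a set) \<Rightarrow> ('i \<Rightarrow> 'a set) topology" where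
  "quot_limit_topology R I \<aa> =
     subtopology (product_topology (\<lambda>i. discrete_topology (carrier (R Quot \<aa> i))) I)
       (carrier (quot_limit R I \<aa>))"

definition nonzero_ideals :: "('a, 'm) ring_scheme \<Rightarrow> 'a set set" where
  "nonzero_ideals D = {\<aa>. ideal \<aa> D \<and> \<aa> \<noteq> {\<zero>\<^bsub>D\<^esub>}}"

definition nonzero_primes :: "('a, 'm) ring_scheme \<Rightarrow> 'a set set" where
  "nonzero_primes D = {\<pp>. primeideal \<pp> D \<and> \<pp> \<noteq> {\<zero>\<^bsub>D\<^esub>}}"

definition ideal_power :: "('a, 'm) ring_scheme \<Rightarrow> 'a set \<Rightarrow> nat \<Rightarrow> 'a set" where
  "ideal_power D \<aa> j = \<aa> [^]\<^bsub>ideals_set D\<^esub> j"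

definition Dhat :: "('a, 'm) ring_scheme \<Rightarrow> ('a set \<Rightarrow> 'a set) ring" where
  "Dhat D = quot_limit D (nonzero_ideals D) (\<lambda>\<aa>. \<aa>)"

definition Dhat_topology :: "('a, 'm) ring_scheme \<Rightarrow> ('a set \<Rightarrow> 'a set) topology" where
  "Dhat_topology D = quot_limit_topology D (nonzero_ideals D) (\<lambda>\<aa>. \<aa>)"

definition Dhat_at_topology :: "('a, 'm) ring_scheme \<Rightarrow> 'a set \<Rightarrow> (nat \<Rightarrow> 'a set) topology" where
  "Dhat_at_topology D \<pp> = quot_limit_topology D UNIV (ideal_power D \<pp>)"

definition Dhat_embed :: "('a, 'm) ring_scheme \<Rightarrow> 'a \<Rightarrow> ('a set \<Rightarrow> 'a set)" where
  "Dhat_embed D r = (\<lambda>\<aa>\<in>nonzero_ideals D. \<aa> +>\<^bsub>D\<^esub> r)"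

text \<open>The \<open>k\<close>-tuples \<open>(x\<^sub>1, \<dots>, x\<^sub>k)\<close> are functions on \<open>{..<k}\<close>.\<close>

definition Dhat_power_topology ::
    "('a, 'm) ring_scheme \<Rightarrow> nat \<Rightarrow> (nat \<Rightarrow> 'a set \<Rightarrow> 'a set) topology" where
  "Dhat_power_topology D k = product_topology (\<lambda>_. Dhat_topology D) {..<k}"

definition Dhat_at_power_topology ::
    "('a, 'm) ring_scheme \<Rightarrow> nat \<Rightarrow> 'a set \<Rightarrow> (nat \<Rightarrow> nat \<Rightarrow> 'a set) topology" where
  "Dhat_at_power_topology D k \<pp> = product_topology (\<lambda>_. Dhat_at_topology D \<pp>) {..<k}"

definition proj_at ::
    "('a, 'm) ring_scheme \<Rightarrow> nat \<Rightarrow> 'a set \<Rightarrow> (nat \<Rightarrow> 'a set \<Rightarrow> 'a set) \<Rightarrow> (nat \<Rightarrow> nat \<Rightarrow> 'a set)" where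
  "proj_at D k \<pp> x = (\<lambda>i\<in>{..<k}. \<lambda>j. x i (ideal_power D \<pp> j))"


section \<open>Eulerian sets\<close>

text \<open>The infix notation \<open>closure_of\<close> and the variable name \<open>X\<close> clash with notation of
  \<open>HOL-Algebra\<close>, so the former is written prefix and subsets of \<open>Dhat\<^sup>k\<close> are called \<open>Y\<close>.\<close>

definition Dhat_closure ::
    "('a, 'm) ring_scheme \<Rightarrow> nat \<Rightarrow> (nat \<Rightarrow> 'a set \<Rightarrow> 'a set) set \<Rightarrow> (nat \<Rightarrow> 'a set \<Rightarrow> 'a set) set" where
  "Dhat_closure D k Y = Abstract_Topology.closure_of (Dhat_power_topology D k) Y"

definition local_closure ::
    "('a, 'm) ring_scheme \<Rightarrow> nat \<Rightarrow> (nat \<Rightarrow> 'a set \<Rightarrow> 'a set) set \<Rightarrow> 'a set \<Rightarrow> (nat \<Rightarrow> nat \<Rightarrow> 'a set) set" where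
  "local_closure D k Y \<pp> = Abstract_Topology.closure_of (Dhat_at_power_topology D k \<pp>) (proj_at D k \<pp> ` Y)"

text \<open>The equality of the closure with the product of the local closures is read through the
  canonical identification of \<open>Dhat\<^sup>k\<close> with the product over \<open>\<pp>\<close> of the \<open>Dhat\<^sub>\<pp>\<^sup>k\<close>, whose components
  are the maps \<^const>\<open>proj_at\<close>.\<close>

definition eulerian ::
    "('a, 'm) ring_scheme \<Rightarrow> nat \<Rightarrow> (nat \<Rightarrow> 'a set \<Rightarrow> 'a set) set \<Rightarrow> bool" where
  "eulerian D k Y \<longleftrightarrow>
     (\<lambda>x. \<lambda>\<pp>\<in>nonzero_primes D. proj_at D k \<pp> x) ` Dhat_closure D k Y =
     (\<Pi>\<^sub>E \<pp>\<in>nonzero_primes D. local_closure D k Y \<pp>)"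

definition openly_eulerian ::
    "('a, 'm) ring_scheme \<Rightarrow> nat \<Rightarrow> (nat \<Rightarrow> 'a set \<Rightarrow> 'a set) set \<Rightarrow> bool" where
  "openly_eulerian D k Y \<longleftrightarrow> eulerian D k Y \<and>
     (\<forall>\<pp>\<in>nonzero_primes D. openin (Dhat_at_power_topology D k \<pp>) (local_closure D k Y \<pp>))"

definition poly_map ::
    "('a, 'm) ring_scheme \<Rightarrow> nat \<Rightarrow> (nat \<Rightarrow> nat \<Rightarrow> 'a) \<Rightarrow> ('a set \<Rightarrow> 'a set) \<Rightarrow> (nat \<Rightarrow> 'a set \<Rightarrow> 'a set)" where
  "poly_map D k f a = (\<lambda>i\<in>{..<k}. UnivPoly.eval D (Dhat D) (Dhat_embed D) a (f i))"


section \<open>Haar measure and procounting distributions\<close>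

text \<open>The Haar measure of total mass 1 on the additive group of \<open>R\<close>, compact under the topology
  \<open>T\<close>: a regular translation-invariant Borel measure.\<close>

definition normalized_haar_measure ::
    "('b, 'n) ring_scheme \<Rightarrow> 'b topology \<Rightarrow> 'b measure \<Rightarrow> bool" where
  "normalized_haar_measure R T M \<longleftrightarrow>
     sets M = sets (sigma (topspace T) {U. openin T U}) \<and>
     (\<forall>x\<in>carrier R. \<forall>A\<in>sets M. emeasure M ((\<lambda>y. x \<oplus>\<^bsub>R\<^esub> y) ` A) = emeasure M A) \<and>
     emeasure M (space M) = 1 \<and>
     (\<forall>A\<in>sets M. emeasure M A = (INF U\<in>{U. openin T U \<and> A \<subseteq> U}. emeasure M U)) \<and>
     (\<forall>U. openin T U \<longrightarrow> emeasure M U = (SUP K\<in>{K. compactin T K \<and> K \<subseteq> U}. emeasure M K))"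

text \<open>In the next definition \<open>M\<close> stands for the normalized Haar measure on \<open>Dhat\<close>. The projection
  \<open>Dhat \<rightarrow> D/\<aa>\<close> is the evaluation \<open>x \<mapsto> x \<aa>\<close>.\<close>

definition approx_measure ::
    "('a, 'm) ring_scheme \<Rightarrow> ('a set \<Rightarrow> 'a set) measure \<Rightarrow> ('a set \<Rightarrow> 'a set) set \<Rightarrow> 'a set
      \<Rightarrow> ('a set \<Rightarrow> 'a set) measure" where
  "approx_measure D M S \<aa> =
     (if S = {} then null_measure M
      else density M (\<lambda>x.
        ennreal (real (card (carrier (D Quot \<aa>))) / real (card ((\<lambda>y. y \<aa>) ` S))) *
        indicator {y \<in> carrier (Dhat D). y \<aa> \<in> (\<lambda>z. z \<aa>) ` S} x))"

text \<open>A distribution is a linear functional on the space of locally constant complex functions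
  with compact support (extended by zero outside the topological space).\<close>

definition test_functions :: "'b topology \<Rightarrow> ('b \<Rightarrow> complex) set" where
  "test_functions T =
     {\<phi>. (\<forall>x\<in>topspace T. \<exists>U. openin T U \<and> x \<in> U \<and> (\<forall>y\<in>U. \<phi> y = \<phi> x)) \<and>
         (\<exists>K. compactin T K \<and> (\<forall>x. x \<notin> K \<longrightarrow> \<phi> x = 0))}"

definition distribution :: "'b topology \<Rightarrow> (('b \<Rightarrow> complex) \<Rightarrow> complex) \<Rightarrow> bool" where
  "distribution T \<mu> \<longleftrightarrow>
     (\<forall>\<phi>\<in>test_functions T. \<forall>\<psi>\<in>test_functions T. \<mu> (\<lambda>x. \<phi> x + \<psi> x) = \<mu> \<phi> + \<mu> \<psi>) \<and>
     (\<forall>c. \<forall>\<phi>\<in>test_functions T. \<mu> (\<lambda>x. c * \<phi> x) = c * \<mu> \<phi>)"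

definition ideals_to_zero :: "('a, 'm) ring_scheme \<Rightarrow> 'a set filter" where
  "ideals_to_zero D =
     (INF \<bb>\<in>nonzero_ideals D. principal {\<aa> \<in> nonzero_ideals D. \<bb> divides\<^bsub>ideals_set D\<^esub> \<aa>})"

definition is_procounting_distribution ::
    "('a, 'm) ring_scheme \<Rightarrow> ('a set \<Rightarrow> 'a set) measure \<Rightarrow> ('a set \<Rightarrow> 'a set) set
      \<Rightarrow> ((('a set \<Rightarrow> 'a set) \<Rightarrow> complex) \<Rightarrow> complex) \<Rightarrow> bool" where
  "is_procounting_distribution D M S \<mu> \<longleftrightarrow>
     distribution (Dhat_topology D) \<mu> \<and>
     (\<forall>U. openin (Dhat_topology D) U \<and> compactin (Dhat_topology D) U \<longrightarrow>
        ((\<lambda>\<aa>. integral\<^sup>L (approx_measure D M S \<aa>) (indicator U :: _ \<Rightarrow> complex))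
           \<longlongrightarrow> \<mu> (indicator U)) (ideals_to_zero D))"

end

theory Submission
  imports Defs
begin

text \<open>The existence of a normalized Haar measure \<open>M\<close> forces all quotients of \<open>D\<close> by non-zero ideals
  to be finite: cosets are translates of each other, and \<open>M\<close> is inner regular. This finiteness
  and the absence of zero divisors are the only arithmetic properties of \<open>D\<close> that are needed. They make
  non-zero primes maximal and every non-zero ideal contain a finite intersection of prime powers,
  so by the Chinese remainder theorem elements of \<open>Dhat\<close> can be prescribed prime by prime.

  The set \<open>Z = f\<^sup>-\<^sup>1(closure of Y)\<close> is then cut out by one condition at each prime \<open>P\<close>, and by
  compactness the condition at \<open>P\<close> depends only on the residue modulo some \<open>P\<^sup>N\<close>. Given an ideal
  \<open>B\<close>, let \<open>E \<subseteq> B\<close> be an intersection of such powers over the primes that matter for \<open>B\<close>. For every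
  \<open>A \<subseteq> E\<close> the fibres of the projection from \<open>Z\<close> modulo \<open>A\<close> to \<open>Z\<close> modulo \<open>E\<close> are translates of
  each other, hence equinumerous. So the integral of a function that factors through \<open>D/B\<close> against
  the approximating measure at \<open>A\<close> does not depend on \<open>A \<subseteq> E\<close>: the net is eventually constant.\<close>

section \<open>Ideals in domains with finite quotients\<close>

text \<open>The normalising factor of the approximating measure is what lets the net settle. Each
  integral is the plain average of the test function over the residues of \<open>Z\<close> modulo
  \<open>A\<close>. The primes away from \<open>B\<close> only affect how many of these residues lie
  over a residue modulo \<open>E\<close>, and that multiplicity cancels. So no infinite product of
  local densities has to converge, and the limit exists even where \<open>Z\<close> has measure 0.
  The obstacle is that factorisation into primes is not established for \<open>D\<close>: an ideal
  \<open>A\<close> is only known to contain a meet of prime powers, so the residues of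
  \<open>Z\<close> modulo \<open>A\<close> are not visibly a product over the primes and cannot be
  counted prime by prime. Hence fibres are compared by an explicit translation. The translating
  element of \<open>D\<close> is controlled at finitely many primes only, whereas membership in
  \<open>Z\<close> concerns all of them; gluing in \<open>Dhat\<close> repairs this by leaving the
  other primes untouched.\<close>

no_notation Sum_Type.Plus (infixr \<open><+>\<close> 65)

context ring
begin

lemma Quot_cases:
  assumes "c \<in> carrier (R Quot I)"
  obtains r where "r \<in> carrier R" "c = I +> r"
  using assms by (auto simp: FactRing_def A_RCOSETS_def')

lemma a_rcos_in_Quot: "r \<in> carrier R \<Longrightarrow> I +> r \<in> carrier (R Quot I)"
  by (auto simp: FactRing_def A_RCOSETS_def')

lemma ideal_subset_set_add:
  assumes "ideal I R" "ideal J R"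
  shows "I \<subseteq> I <+> J" "J \<subseteq> I <+> J"
proof -
  interpret I: ideal I R by fact
  interpret J: ideal J R by fact
  have "x \<oplus> \<zero> \<in> I <+> J" if "x \<in> I" for x
    unfolding set_add_def' using that J.zero_closed by blast
  then show "I \<subseteq> I <+> J" using I.Icarr by fastforce
  have "\<zero> \<oplus> x \<in> I <+> J" if "x \<in> J" for x
    unfolding set_add_def' using that I.zero_closed by blast
  then show "J \<subseteq> I <+> J" using J.Icarr by fastforce
qed

lemma ideal_set_add_absorb:
  assumes "ideal I R" "ideal J R" "I \<subseteq> J"
  shows "J <+> I = J"
proof
  interpret I: ideal I R by fact
  interpret J: ideal J R by fact
  show "J <+> I \<subseteq> J"
    using assms(3) by (auto simp: set_add_def')
  show "J \<subseteq> J <+> I"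
    using ideal_subset_set_add[OF assms(2,1)] by simp
qed

lemma set_add_a_rcos:
  assumes "ideal I R" "ideal J R" "I \<subseteq> J" "r \<in> carrier R"
  shows "J <+> (I +> r) = J +> r"
proof -
  interpret I: ideal I R by fact
  interpret J: ideal J R by fact
  have "J <+> (I +> r) = (J <+> I) +> r"
    using assms by (intro a_setmult_rcos_assoc) auto
  then show ?thesis
    using ideal_set_add_absorb[OF assms(1-3)] by simp
qed

text \<open>Multiply the two decompositions of \<open>\<one>\<close>: every term except
  \<open>j \<otimes> k\<close> has a factor in \<open>I\<close>.\<close>

lemma comaximal_ideal_prod:
  assumes I: "ideal I R" and J: "ideal J R" and K: "ideal K R"
    and IJ: "I <+> J = carrier R" and IK: "I <+> K = carrier R"
  shows "I <+> J \<cdot> K = carrier R"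
proof -
  interpret I: ideal I R by fact
  interpret J: ideal J R by fact
  interpret K: ideal K R by fact
  have "\<one> \<in> I <+> J" "\<one> \<in> I <+> K"
    using IJ IK by auto
  then obtain i j i' k where e: "i \<in> I" "j \<in> J" "\<one> = i \<oplus> j" "i' \<in> I" "k \<in> K" "\<one> = i' \<oplus> k"
    by (auto simp: set_add_def')
  note c = I.Icarr[OF e(1)] J.Icarr[OF e(2)] I.Icarr[OF e(4)] K.Icarr[OF e(5)]
  have "\<one> = (i \<oplus> j) \<otimes> (i' \<oplus> k)"
    using e(3,6) by (metis l_one one_closed)
  also have "\<dots> = (i \<otimes> (i' \<oplus> k) \<oplus> j \<otimes> i') \<oplus> j \<otimes> k"
    using c by (simp add: l_distr r_distr a_ac)
  finally have "\<one> = (i \<otimes> (i' \<oplus> k) \<oplus> j \<otimes> i') \<oplus> j \<otimes> k" .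
  moreover have "i \<otimes> (i' \<oplus> k) \<oplus> j \<otimes> i' \<in> I"
    using c e by (simp add: I.I_l_closed I.I_r_closed)
  moreover have "j \<otimes> k \<in> J \<cdot> K"
    using e by (simp add: ideal_prod.prod)
  ultimately have "\<one> \<in> I <+> J \<cdot> K"
    unfolding set_add_def' by blast
  with add_ideals[OF I ideal_prod_is_ideal[OF J K]] show ?thesis
    by (rule ideal.one_imp_carrier)
qed

lemma ideal_prod_mono:
  assumes "I \<subseteq> I'" "J \<subseteq> J'"
  shows "I \<cdot> J \<subseteq> I' \<cdot> J'"
proof
  fix x assume "x \<in> I \<cdot> J"
  then show "x \<in> I' \<cdot> J'"
    using assms by induct (auto intro: ideal_prod.intros)
qed

end

section \<open>Powers of ideals and Chinese remaindering\<close>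

context cring
begin

lemma ideal_power_0 [simp]: "ideal_power R I 0 = carrier R"
  by (simp add: ideal_power_def ideals_set_def)

lemma ideal_power_Suc [simp]: "ideal_power R I (Suc n) = ideal_power R I n \<cdot> I"
  by (simp add: ideal_power_def ideals_set_def)

lemma ideal_power_ideal:
  assumes "ideal I R"
  shows "ideal (ideal_power R I n) R"
  by (induction n) (use assms in \<open>auto intro: oneideal ideal_prod_is_ideal\<close>)

lemma ideal_power_antimono:
  assumes "ideal I R" "m \<le> n"
  shows "ideal_power R I n \<subseteq> ideal_power R I m"
  using assms(2)
proof (induction n rule: dec_induct)
  case (step n)
  then show ?case
    using ideal_prod_inter[OF ideal_power_ideal[OF assms(1), of n] assms(1)] by auto
qed simp

lemma ideal_power_add:
  assumes "ideal I R"
  shows "ideal_power R I (m + n) = ideal_power R I m \<cdot> ideal_power R I n"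
proof -
  interpret S: comm_monoid "ideals_set R" by (rule ideals_set_is_comm_monoid)
  have "I [^]\<^bsub>ideals_set R\<^esub> m \<otimes>\<^bsub>ideals_set R\<^esub> I [^]\<^bsub>ideals_set R\<^esub> n = I [^]\<^bsub>ideals_set R\<^esub> (m + n)"
    using assms by (intro S.nat_pow_mult) (simp add: ideals_set_def)
  then show ?thesis
    by (simp add: ideal_power_def ideals_set_def)
qed

lemma comaximal_ideal_power:
  assumes I: "ideal I R" and J: "ideal J R" and IJ: "I <+> J = carrier R"
  shows "ideal_power R I m <+> ideal_power R J n = carrier R"
proof -
  \<comment> \<open>Only one exponent is raised at a time. The claim is applied first to raise
    \<open>I\<close>, and then to raise \<open>J\<close> against the power of
    \<open>I\<close>.\<close>
  have *: "K <+> ideal_power R L n = carrier R"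
    if K: "ideal K R" and L: "ideal L R" and KL: "K <+> L = carrier R" for K L and n :: nat
  proof (induction n)
    case 0
    interpret K: ideal K R by fact
    have "carrier R <+> K = carrier R"
      using ideal_set_add_absorb[OF K oneideal K.a_subset] .
    then show ?case
      using set_add_comm[of K "carrier R"] K.a_subset by simp
  next
    case (Suc n)
    then show ?case
      using comaximal_ideal_prod[OF K ideal_power_ideal[OF L] L] KL by simp
  qed
  have sub: "ideal K R \<Longrightarrow> K \<subseteq> carrier R" for K
    by (meson additive_subgroup.a_subset ideal.axioms(1))
  have "ideal_power R I m <+> J = carrier R"
    using *[OF J I] IJ set_add_comm sub I J ideal_power_ideal[OF I] by metis
  then show ?thesis
    by (rule *[OF ideal_power_ideal[OF I] J])
qed

text \<open>Each \<open>J k\<close> contains an element congruent to \<open>\<one>\<close> modulo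
  \<open>I\<close>; the product of these elements is the witness. It serves as the interpolating
  idempotent of the Chinese remainder theorem and shows that a prime power is comaximal with a meet
  of other prime powers.\<close>

lemma comaximal_separating_element:
  assumes "finite K" "ideal I R"
    and "\<And>k. k \<in> K \<Longrightarrow> ideal (J k) R" "\<And>k. k \<in> K \<Longrightarrow> J k <+> I = carrier R"
  shows "\<exists>e\<in>carrier R. (\<forall>k\<in>K. e \<in> J k) \<and> \<one> \<ominus> e \<in> I"
  using assms(1,3,4)
proof (induction K)
  case empty
  have "\<one> \<ominus> \<one> \<in> I"
    using additive_subgroup.zero_closed[OF ideal.axioms(1)[OF assms(2)]] by (simp add: r_neg minus_eq)
  then show ?case
    by auto
next
  case (insert k K)
  interpret I: ideal I R by fact
  interpret J: ideal "J k" R using insert.prems by auto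
  obtain e where e: "e \<in> carrier R" "\<forall>k\<in>K. e \<in> J k" "\<one> \<ominus> e \<in> I"
    using insert by auto
  have "\<one> \<in> J k <+> I"
    using insert.prems by auto
  then obtain u v where u: "u \<in> J k" "v \<in> I" "\<one> = u \<oplus> v"
    by (auto simp: set_add_def')
  have c: "u \<in> carrier R" "v \<in> carrier R"
    using u by auto
  have "\<one> \<ominus> e \<otimes> u = (\<one> \<ominus> e) \<oplus> (e \<otimes> (u \<oplus> v) \<ominus> e \<otimes> u)"
    using e(1) c u(3)[symmetric] by simp algebra
  also have "\<dots> = (\<one> \<ominus> e) \<oplus> e \<otimes> v"
    using e(1) c by algebra
  finally have "\<one> \<ominus> e \<otimes> u \<in> I"
    using e u by (simp add: I.I_l_closed)
  moreover have "e \<otimes> u \<in> J l" if "l \<in> insert k K" for l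
  proof -
    interpret L: ideal "J l" R using insert.prems that by auto
    show ?thesis
      using that e u c L.I_l_closed[of u e] L.I_r_closed[of e u] by (cases "l = k") auto
  qed
  ultimately show ?case
    using e c by (intro bexI[of _ "e \<otimes> u"]) auto
qed

lemma chinese_remainder_elements:
  assumes "finite K"
    and "\<And>k. k \<in> K \<Longrightarrow> ideal (J k) R"
    and "\<And>k l. \<lbrakk>k \<in> K; l \<in> K; k \<noteq> l\<rbrakk> \<Longrightarrow> J k <+> J l = carrier R"
    and "\<And>k. k \<in> K \<Longrightarrow> s k \<in> carrier R"
  shows "\<exists>r\<in>carrier R. \<forall>k\<in>K. r \<ominus> s k \<in> J k"
  using assms
proof (induction K)
  case (insert k K)
  have "\<exists>r\<in>carrier R. \<forall>k\<in>K. r \<ominus> s k \<in> J k"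
    by (rule insert.IH) (use insert.prems in auto)
  then obtain r where r: "r \<in> carrier R" "\<forall>k\<in>K. r \<ominus> s k \<in> J k"
    by auto
  have "\<exists>e\<in>carrier R. (\<forall>l\<in>K. e \<in> J l) \<and> \<one> \<ominus> e \<in> J k"
    by (rule comaximal_separating_element) (use insert in auto)
  then obtain e where e: "e \<in> carrier R" "\<forall>k\<in>K. e \<in> J k" "\<one> \<ominus> e \<in> J k"
    by auto
  have sk: "s k \<in> carrier R"
    using insert.prems by auto
  \<comment> \<open>Interpolation: \<open>e\<close> is 0 modulo the old ideals, where
    \<open>t\<close> therefore agrees with \<open>r\<close>, and 1 modulo \<open>J k\<close>, where
    it agrees with \<open>s k\<close>.\<close>
  define t where "t = r \<oplus> e \<otimes> (s k \<ominus> r)"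
  have "t \<ominus> s l \<in> J l" if l: "l \<in> insert k K" for l
  proof -
    interpret L: ideal "J l" R using insert.prems l by auto
    have sl: "s l \<in> carrier R" using insert.prems l by auto
    show ?thesis
    proof (cases "l = k")
      case True
      have "t \<ominus> s k = (\<one> \<ominus> e) \<otimes> (r \<ominus> s k)"
        unfolding t_def using r e sk by algebra
      then show ?thesis
        using L.I_r_closed[of "\<one> \<ominus> e" "r \<ominus> s k"] True e sk r by simp
    next
      case False
      have "t \<ominus> s l = (r \<ominus> s l) \<oplus> e \<otimes> (s k \<ominus> r)"
        unfolding t_def using r e sk sl by algebra
      then show ?thesis
        using False l e sk r by (simp add: L.I_r_closed)
    qed
  qed
  then show ?case
    using r e sk by (intro bexI[of _ t]) (auto simp: t_def)
qed auto

end

section \<open>Non-zero ideals, primes and meets of prime powers\<close>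

locale finite_quotient_domain = domain +
  assumes finite_Quot: "I \<in> nonzero_ideals R \<Longrightarrow> finite (carrier (R Quot I))"
begin

lemma nonzero_idealD: "I \<in> nonzero_ideals R \<Longrightarrow> ideal I R"
  by (simp add: nonzero_ideals_def)

lemma nonzero_primeD: "P \<in> nonzero_primes R \<Longrightarrow> ideal P R"
  by (simp add: nonzero_primes_def primeideal.axioms(1))

lemma nonzero_ideal_obtains:
  assumes "I \<in> nonzero_ideals R"
  obtains x where "x \<in> I" "x \<noteq> \<zero>" "x \<in> carrier R"
proof -
  interpret ideal I R using assms by (rule nonzero_idealD)
  show ?thesis
    using assms that zero_closed by (auto simp: nonzero_ideals_def)
qed

lemma nonzero_ideals_ideal_prod:
  assumes "I \<in> nonzero_ideals R" "J \<in> nonzero_ideals R"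
  shows "I \<cdot> J \<in> nonzero_ideals R"
proof -
  obtain x y where xy: "x \<in> I" "x \<noteq> \<zero>" "x \<in> carrier R" "y \<in> J" "y \<noteq> \<zero>" "y \<in> carrier R"
    using assms nonzero_ideal_obtains by metis
  have "x \<otimes> y \<in> I \<cdot> J" "x \<otimes> y \<noteq> \<zero>"
    using xy by (auto intro: ideal_prod.prod simp: integral_iff)
  then show ?thesis
    using ideal_prod_is_ideal[OF assms[THEN nonzero_idealD]] by (auto simp: nonzero_ideals_def)
qed

lemma nonzero_ideals_superset:
  assumes "I \<in> nonzero_ideals R" "ideal J R" "I \<subseteq> J"
  shows "J \<in> nonzero_ideals R"
  using assms(2,3) nonzero_ideal_obtains[OF assms(1)] by (auto simp: nonzero_ideals_def)

lemma carrier_nonzero_ideal: "carrier R \<in> nonzero_ideals R"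
  using oneideal one_not_zero one_closed unfolding nonzero_ideals_def by blast

lemma nonzero_ideals_Int:
  assumes "I \<in> nonzero_ideals R" "J \<in> nonzero_ideals R"
  shows "I \<inter> J \<in> nonzero_ideals R"
  by (intro nonzero_ideals_superset[OF nonzero_ideals_ideal_prod[OF assms]]
    i_intersect ideal_prod_inter assms[THEN nonzero_idealD])

text \<open>Directedness of the index set of \<open>Dhat\<close>: it lets compactness arguments
  replace finitely many levels by a single one.\<close>

lemma nonzero_ideals_directed:
  assumes "finite K" "K \<subseteq> nonzero_ideals R"
  shows "\<exists>I\<in>nonzero_ideals R. \<forall>J\<in>K. I \<subseteq> J"
  using assms
proof (induction K)
  case (insert J K)
  then obtain I where "I \<in> nonzero_ideals R" "\<forall>J\<in>K. I \<subseteq> J" by auto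
  then show ?case
    using insert.prems nonzero_ideals_Int[of I J] by (intro bexI[of _ "I \<inter> J"]) auto
qed (use carrier_nonzero_ideal in auto)

lemma nonzero_prime_nonzero_ideal: "P \<in> nonzero_primes R \<Longrightarrow> P \<in> nonzero_ideals R"
  by (simp add: nonzero_primes_def nonzero_ideals_def primeideal.axioms(1))

lemma ideal_power_nonzero:
  "I \<in> nonzero_ideals R \<Longrightarrow> ideal_power R I n \<in> nonzero_ideals R"
  by (induction n) (auto intro: nonzero_ideals_ideal_prod carrier_nonzero_ideal)

text \<open>A finite integral domain is a field: multiplication by the class of some
  \<open>x \<in> J - P\<close> is injective on the finite quotient, hence hits the unit.\<close>

lemma nonzero_prime_maximal:
  assumes P: "P \<in> nonzero_primes R" and J: "ideal J R" "P \<subseteq> J" "\<not> J \<subseteq> P"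
  shows "J = carrier R"
proof -
  interpret P: primeideal P R using P by (simp add: nonzero_primes_def)
  interpret J: ideal J R by fact
  obtain x where x: "x \<in> J" "x \<notin> P" using J by auto
  have xc: "x \<in> carrier R" using x by auto
  let ?Q = "carrier (R Quot P)"
  have fin: "finite ?Q"
    using finite_Quot nonzero_prime_nonzero_ideal[OF P] by auto
  define g where "g = (\<lambda>c. (P +> x) \<otimes>\<^bsub>R Quot P\<^esub> c)"
  interpret Q: domain "R Quot P" by (rule P.quotient_is_domain)
  have xQ: "P +> x \<in> ?Q" using xc by (rule a_rcos_in_Quot)
  have xz: "P +> x \<noteq> \<zero>\<^bsub>R Quot P\<^esub>"
    using P.rcos_const_imp_mem[OF xc] x by (auto simp: FactRing_def)
  have "inj_on g ?Q"
    by (rule inj_onI) (use xQ xz Q.m_lcancel in \<open>auto simp: g_def\<close>)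
  moreover have "g ` ?Q \<subseteq> ?Q"
    using xQ by (auto simp: g_def)
  ultimately have "g ` ?Q = ?Q"
    by (intro endo_inj_surj[OF fin])
  with Q.one_closed have "\<one>\<^bsub>R Quot P\<^esub> \<in> g ` ?Q"
    by blast
  then obtain c where c: "c \<in> ?Q" "(P +> x) \<otimes>\<^bsub>R Quot P\<^esub> c = \<one>\<^bsub>R Quot P\<^esub>"
    by (auto simp: g_def)
  obtain r where r: "r \<in> carrier R" "c = P +> r"
    using c(1) by (rule Quot_cases)
  have "P +> (x \<otimes> r) = P +> \<one>"
    using c r xc by (simp add: FactRing_def P.rcoset_mult_add)
  then have "x \<otimes> r \<ominus> \<one> \<in> P"
    using quotient_eq_iff_same_a_r_cos[OF P.is_ideal, of "x \<otimes> r" \<one>] xc r by auto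
  then have "x \<otimes> r \<ominus> \<one> \<in> J" using J by auto
  moreover have "\<one> = x \<otimes> r \<ominus> (x \<otimes> r \<ominus> \<one>)"
    using xc r by algebra
  moreover have "x \<otimes> r \<in> J" using x r by (auto intro: J.I_r_closed)
  ultimately have "\<one> \<in> J"
    using J.a_closed[OF _ J.a_inv_closed, of "x \<otimes> r" "x \<otimes> r \<ominus> \<one>"] by (simp add: minus_eq)
  then show ?thesis by (rule J.one_imp_carrier)
qed

lemma nonzero_primes_comaximal:
  assumes P: "P \<in> nonzero_primes R" and Q: "Q \<in> nonzero_primes R" and "P \<noteq> Q"
  shows "ideal_power R P m <+> ideal_power R Q n = carrier R"
proof (rule comaximal_ideal_power)
  show iP: "ideal P R" and iQ: "ideal Q R"
    using P Q by (auto dest: nonzero_primeD)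
  have ne: "P \<noteq> carrier R" "Q \<noteq> carrier R"
    using P Q by (auto simp: nonzero_primes_def dest: primeideal.I_notcarr)
  have "\<not> Q \<subseteq> P"
    using nonzero_prime_maximal[OF Q iP] ne \<open>P \<noteq> Q\<close> by blast
  note sub = ideal_subset_set_add[OF iP iQ]
  show "P <+> Q = carrier R"
    using nonzero_prime_maximal[OF P add_ideals[OF iP iQ] sub(1)] sub(2) \<open>\<not> Q \<subseteq> P\<close> by blast
qed

text \<open>The intersection is taken inside \<^term>\<open>carrier R\<close> so that the empty set of primes, which
  is the only one when \<^term>\<open>R\<close> is a field, yields the unit ideal.\<close>

definition prime_power_meet :: "'a set set \<Rightarrow> nat \<Rightarrow> 'a set" where
  "prime_power_meet T n = {x \<in> carrier R. \<forall>P\<in>T. x \<in> ideal_power R P n}"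

lemma prime_power_meet_empty [simp]: "prime_power_meet {} n = carrier R"
  by (simp add: prime_power_meet_def)

lemma prime_power_meet_insert:
  "ideal P R \<Longrightarrow> prime_power_meet (insert P T) n = ideal_power R P n \<inter> prime_power_meet T n"
  using additive_subgroup.a_subset[OF ideal.axioms(1)[OF ideal_power_ideal[of P n]]]
  by (auto simp: prime_power_meet_def)

lemma prime_power_meet_antimono:
  assumes "T' \<subseteq> nonzero_primes R" "T \<subseteq> T'" "m \<le> n"
  shows "prime_power_meet T' n \<subseteq> prime_power_meet T m"
  using assms ideal_power_antimono nonzero_primeD unfolding prime_power_meet_def by blast

lemma prime_power_meet_nonzero:
  assumes "finite T" "T \<subseteq> nonzero_primes R"
  shows "prime_power_meet T n \<in> nonzero_ideals R"
  using assms
proof (induction T)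
  case (insert P T)
  then show ?case
    using prime_power_meet_insert[OF nonzero_primeD, of P T n]
      nonzero_ideals_Int[OF ideal_power_nonzero[OF nonzero_prime_nonzero_ideal], of P _ n]
    by auto
qed (auto intro: carrier_nonzero_ideal)

lemma prime_power_meet_comaximal:
  assumes "finite T" "T \<subseteq> nonzero_primes R" "P \<in> nonzero_primes R" "P \<notin> T"
  shows "ideal_power R P n <+> prime_power_meet T n = carrier R"
proof -
  interpret P: ideal "ideal_power R P n" R
    using assms nonzero_primeD by (intro ideal_power_ideal) auto
  have "\<exists>e\<in>carrier R. (\<forall>k\<in>T. e \<in> ideal_power R k n) \<and> \<one> \<ominus> e \<in> ideal_power R P n"
    using assms
    by (intro comaximal_separating_element P.is_ideal ideal_power_ideal nonzero_primes_comaximal)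
      (auto intro: nonzero_primeD)
  then obtain e where e: "e \<in> carrier R" "e \<in> prime_power_meet T n" "\<one> \<ominus> e \<in> ideal_power R P n"
    by (auto simp: prime_power_meet_def)
  have "\<one> = (\<one> \<ominus> e) \<oplus> e" using e by algebra
  then have "\<one> \<in> ideal_power R P n <+> prime_power_meet T n"
    unfolding set_add_def' using e by blast
  with add_ideals[OF P.is_ideal nonzero_idealD[OF prime_power_meet_nonzero[OF assms(1,2)]]]
  show ?thesis
    by (rule ideal.one_imp_carrier)
qed

text \<open>Comaximal ideals meet in their product, so the meets are products in the commutative
  monoid of ideals and their factors can be regrouped prime by prime.\<close>

lemma prime_power_meet_add:
  assumes "finite T" "T \<subseteq> nonzero_primes R"
  shows "prime_power_meet T (m + n) \<subseteq> prime_power_meet T m \<cdot> prime_power_meet T n"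
  using assms
proof (induction T)
  case (insert P T)
  interpret S: comm_monoid "ideals_set R" by (rule ideals_set_is_comm_monoid)
  have mult: "x \<otimes>\<^bsub>ideals_set R\<^esub> y = x \<cdot> y" for x y
    by (simp add: ideals_set_def)
  have P: "P \<in> nonzero_primes R" "ideal P R" and T: "T \<subseteq> nonzero_primes R"
    using insert.prems nonzero_primeD by auto
  let ?p = "ideal_power R P" and ?t = "prime_power_meet T"
  have i: "?p k \<in> carrier (ideals_set R)" "?t k \<in> carrier (ideals_set R)"
    "ideal (?p k) R" "ideal (?t k) R" for k
    using P ideal_power_ideal nonzero_idealD[OF prime_power_meet_nonzero[OF insert.hyps(1) T]]
    by (auto simp: ideals_set_def)
  have eq: "prime_power_meet (insert P T) k = ?p k \<cdot> ?t k" for k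
    using prime_power_meet_insert[OF P(2)] prime_power_meet_comaximal[OF insert.hyps(1) T P(1) insert.hyps(2)]
      ideal_prod_eq_inter[OF i(3,4)] by simp
  have "?p (m + n) \<cdot> ?t (m + n) \<subseteq> (?p m \<cdot> ?p n) \<cdot> (?t m \<cdot> ?t n)"
    using insert.IH[OF T] by (intro ideal_prod_mono) (auto simp: ideal_power_add[OF P(2)])
  also have "(?p m \<cdot> ?p n) \<cdot> (?t m \<cdot> ?t n) = (?p m \<cdot> ?t m) \<cdot> (?p n \<cdot> ?t n)"
    using i(1,2) unfolding mult[symmetric] by (simp add: S.m_ac)
  finally show ?case
    by (simp add: eq)
qed (simp add: ideal_prod_one oneideal)

text \<open>Supplies the decreasing measure for the next induction, in place of the ascending chain
  condition. Reduction from \<open>R Quot I\<close> to \<open>R Quot J\<close> is onto, and it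
  identifies the class of some \<open>z \<in> J - I\<close> with zero.\<close>

lemma card_Quot_less:
  assumes I: "I \<in> nonzero_ideals R" and J: "ideal J R" "I \<subset> J"
  shows "card (carrier (R Quot J)) < card (carrier (R Quot I))"
proof -
  interpret I: ideal I R using I by (rule nonzero_idealD)
  interpret J: ideal J R by fact
  let ?g = "\<lambda>c. J <+> c"
  have g: "?g (I +> r) = J +> r" if "r \<in> carrier R" for r
    using set_add_a_rcos I.is_ideal J that by auto
  have "carrier (R Quot J) \<subseteq> ?g ` carrier (R Quot I)"
  proof
    fix c assume "c \<in> carrier (R Quot J)"
    then obtain r where "r \<in> carrier R" "c = J +> r" by (rule Quot_cases)
    then show "c \<in> ?g ` carrier (R Quot I)"
      using g a_rcos_in_Quot by (metis imageI)
  qed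
  moreover have "?g ` carrier (R Quot I) \<subseteq> carrier (R Quot J)"
    using g a_rcos_in_Quot by (auto elim!: Quot_cases)
  ultimately have eq: "?g ` carrier (R Quot I) = carrier (R Quot J)" by blast
  have fin: "finite (carrier (R Quot I))" using I by (rule finite_Quot)
  obtain z where z: "z \<in> J" "z \<notin> I" using J by auto
  have zc: "z \<in> carrier R" using z by auto
  have "\<not> inj_on ?g (carrier (R Quot I))"
  proof
    assume inj: "inj_on ?g (carrier (R Quot I))"
    have "?g (I +> z) = ?g (I +> \<zero>)"
      using g zc z a_rcos_zero[OF J(1)] J.zero_closed by simp
    then have "I +> z = I +> \<zero>"
      using inj zc a_rcos_in_Quot by (auto dest: inj_onD)
    then have "I +> z = I"
      using a_rcos_zero[OF I.is_ideal I.zero_closed] by simp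
    then show False
      using I.rcos_const_imp_mem[OF zc] z by simp
  qed
  then have "card (?g ` carrier (R Quot I)) \<noteq> card (carrier (R Quot I))"
    using eq_card_imp_inj_on[OF fin] by blast
  then show ?thesis
    using card_image_le[OF fin, of ?g] eq by simp
qed

text \<open>The classical Noetherian argument: a proper ideal that is not prime contains a product
  of two ideals that it does not contain. Adding \<open>I\<close> to both gives strictly larger
  ideals whose product is still inside \<open>I\<close>.\<close>

lemma prime_power_meet_subset_nonzero_ideal:
  assumes "I \<in> nonzero_ideals R"
  shows "\<exists>T n. finite T \<and> T \<subseteq> nonzero_primes R \<and> prime_power_meet T n \<subseteq> I"
  using assms
proof (induction "card (carrier (R Quot I))" arbitrary: I rule: less_induct)
  case less
  interpret I: ideal I R using less.prems by (rule nonzero_idealD)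
  consider "I = carrier R" | "I \<in> nonzero_primes R" | "I \<noteq> carrier R" "\<not> primeideal I R"
    using less.prems by (auto simp: nonzero_primes_def nonzero_ideals_def)
  then show ?case
  proof cases
    case 1
    then show ?thesis by (intro exI[of _ "{}"]) auto
  next
    case 2
    have "prime_power_meet {I} 1 \<subseteq> I"
      using I.is_ideal ideal_prod_inter[OF oneideal I.is_ideal] by (auto simp: prime_power_meet_def)
    then show ?thesis using 2 by (intro exI[of _ "{I}"]) auto
  next
    case 3
    then obtain A B where AB: "ideal A R" "ideal B R" "A \<cdot> B \<subseteq> I" "\<not> A \<subseteq> I" "\<not> B \<subseteq> I"
      using divides_ideal_prod_imp_primeideal[OF I.is_ideal] by metis
    have absorb: "I \<subset> I <+> J \<and> ideal (I <+> J) R" if J: "ideal J R" "\<not> J \<subseteq> I" for J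
      using J ideal_subset_set_add[OF I.is_ideal J(1)] add_ideals[OF I.is_ideal J(1)] by blast
    let ?A = "I <+> A" and ?B = "I <+> B"
    have A: "?A \<in> nonzero_ideals R" "I \<subset> ?A" and B: "?B \<in> nonzero_ideals R" "I \<subset> ?B"
      using absorb AB nonzero_ideals_superset[OF less.prems] by blast+
    obtain T m where T: "finite T" "T \<subseteq> nonzero_primes R" "prime_power_meet T m \<subseteq> ?A"
      using less.hyps[OF card_Quot_less[OF less.prems nonzero_idealD[OF A(1)] A(2)] A(1)] by blast
    obtain U n where U: "finite U" "U \<subseteq> nonzero_primes R" "prime_power_meet U n \<subseteq> ?B"
      using less.hyps[OF card_Quot_less[OF less.prems nonzero_idealD[OF B(1)] B(2)] B(1)] by blast
    have "prime_power_meet (T \<union> U) (m + n) \<subseteq>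
        prime_power_meet (T \<union> U) m \<cdot> prime_power_meet (T \<union> U) n"
      using T U by (intro prime_power_meet_add) auto
    also have "\<dots> \<subseteq> ?A \<cdot> ?B"
      using prime_power_meet_antimono[of "T \<union> U" T m m] prime_power_meet_antimono[of "T \<union> U" U n n] T U
      by (intro ideal_prod_mono) auto
    \<comment> \<open>On expanding a product of two sums, three terms have a factor in
      \<open>I\<close> and the fourth lies in \<open>A \<cdot> B\<close>.\<close>
    also have "\<dots> \<subseteq> I"
    proof
      fix x assume "x \<in> ?A \<cdot> ?B"
      then show "x \<in> I"
      proof induct
        case (prod a b)
        then obtain i a' j b' where e: "i \<in> I" "a' \<in> A" "a = i \<oplus> a'" "j \<in> I" "b' \<in> B" "b = j \<oplus> b'"
          by (auto simp: set_add_def')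
        have c: "i \<in> carrier R" "j \<in> carrier R" "a' \<in> carrier R" "b' \<in> carrier R"
          using e AB by (auto intro: ideal.Icarr)
        have "a' \<otimes> b' \<in> I" using e AB by (auto intro: ideal_prod.prod)
        moreover have "a \<otimes> b = i \<otimes> (j \<oplus> b') \<oplus> a' \<otimes> j \<oplus> a' \<otimes> b'"
          unfolding e(3,6) using c by (simp add: l_distr r_distr a_ac)
        ultimately show ?case
          using I.I_r_closed[OF e(1), of "j \<oplus> b'"] I.I_l_closed[OF e(4), of a'] c by simp
      qed (rule I.a_closed)
    qed
    finally show ?thesis
      using T U by (intro exI[of _ "T \<union> U"]) auto
  qed
qed

end

section \<open>The profinite completion\<close>

context cring
begin

text \<open>This is why the componentwise operations of \<open>quot_limit\<close> preserve
  compatibility of families.\<close>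

lemma set_add_ring_hom:
  assumes I: "ideal I R" and J: "ideal J R" and IJ: "I \<subseteq> J"
  shows "(\<lambda>c. J <+> c) \<in> ring_hom (R Quot I) (R Quot J)"
proof -
  interpret I: ideal I R by fact
  interpret J: ideal J R by fact
  note g = set_add_a_rcos[OF I J IJ]
  show ?thesis
  proof (rule ring_hom_memI)
    fix c d assume "c \<in> carrier (R Quot I)" "d \<in> carrier (R Quot I)"
    then obtain r s where "r \<in> carrier R" "c = I +> r" "s \<in> carrier R" "d = I +> s"
      by (metis Quot_cases)
    then show "J <+> (c \<otimes>\<^bsub>R Quot I\<^esub> d) = (J <+> c) \<otimes>\<^bsub>R Quot J\<^esub> (J <+> d)"
      and "J <+> (c \<oplus>\<^bsub>R Quot I\<^esub> d) = (J <+> c) \<oplus>\<^bsub>R Quot J\<^esub> (J <+> d)"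
      by (simp_all add: FactRing_def I.rcoset_mult_add J.rcoset_mult_add I.a_rcos_sum J.a_rcos_sum g)
  next
    fix c assume "c \<in> carrier (R Quot I)"
    then show "J <+> c \<in> carrier (R Quot J)"
      by (auto elim!: Quot_cases simp: g intro: a_rcos_in_Quot)
  next
    show "J <+> \<one>\<^bsub>R Quot I\<^esub> = \<one>\<^bsub>R Quot J\<^esub>"
      by (simp add: FactRing_def g)
  qed
qed

lemma set_add_zero_Quot:
  assumes "ideal I R" "ideal J R" "I \<subseteq> J"
  shows "J <+> \<zero>\<^bsub>R Quot I\<^esub> = \<zero>\<^bsub>R Quot J\<^esub>"
  using ideal_set_add_absorb[OF assms] by (simp add: FactRing_def)

end

lemma quot_limit_simps:
  "x \<otimes>\<^bsub>quot_limit R I A\<^esub> y = (\<lambda>i\<in>I. x i \<otimes>\<^bsub>R Quot A i\<^esub> y i)"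
  "x \<oplus>\<^bsub>quot_limit R I A\<^esub> y = (\<lambda>i\<in>I. x i \<oplus>\<^bsub>R Quot A i\<^esub> y i)"
  "\<one>\<^bsub>quot_limit R I A\<^esub> = (\<lambda>i\<in>I. \<one>\<^bsub>R Quot A i\<^esub>)"
  "\<zero>\<^bsub>quot_limit R I A\<^esub> = (\<lambda>i\<in>I. \<zero>\<^bsub>R Quot A i\<^esub>)"
  by (simp_all add: quot_limit_def)

lemma quot_limit_carrier_iff:
  "x \<in> carrier (quot_limit R I A) \<longleftrightarrow> x \<in> extensional I \<and> (\<forall>i\<in>I. x i \<in> carrier (R Quot A i)) \<and>
     (\<forall>i\<in>I. \<forall>j\<in>I. A i \<subseteq> A j \<longrightarrow> x j = A j <+>\<^bsub>R\<^esub> x i)"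
  by (auto simp: quot_limit_def PiE_iff)

lemma quot_limitD:
  assumes "x \<in> carrier (quot_limit R I A)"
  shows quot_limit_in_Quot: "i \<in> I \<Longrightarrow> x i \<in> carrier (R Quot A i)"
    and quot_limit_compat: "\<lbrakk>i \<in> I; j \<in> I; A i \<subseteq> A j\<rbrakk> \<Longrightarrow> A j <+>\<^bsub>R\<^esub> x i = x j"
    and quot_limit_extensional: "x \<in> extensional I"
  using assms unfolding quot_limit_carrier_iff by metis+

context cring
begin

lemma quot_limit_cring:
  assumes A: "\<And>i. i \<in> I \<Longrightarrow> ideal (A i) R"
  shows "cring (quot_limit R I A)"
proof -
  let ?L = "quot_limit R I A"
  have cr: "cring (R Quot A i)" if "i \<in> I" for i
    using ideal.quotient_is_cring[OF A[OF that] is_cring] .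
  have rg: "ring (R Quot A i)" if "i \<in> I" for i
    using cr[OF that] by (rule cring.axioms)
  have hom: "(\<lambda>c. A j <+> c) \<in> ring_hom (R Quot A i) (R Quot A j)"
    if "i \<in> I" "j \<in> I" "A i \<subseteq> A j" for i j
    using that by (intro set_add_ring_hom A)
  have mem: "x i \<in> carrier (R Quot A i)" if "x \<in> carrier ?L" "i \<in> I" for x i
    using that by (rule quot_limit_in_Quot)
  have comp: "A j <+> x i = x j" if "x \<in> carrier ?L" "i \<in> I" "j \<in> I" "A i \<subseteq> A j" for x i j
    using that by (rule quot_limit_compat)
  \<comment> \<open>The unit laws compare a restricted function with \<open>x\<close> itself, so
    \<open>x\<close> has to be rewritten as its own restriction.\<close>
  have ext: "x = (\<lambda>i\<in>I. x i)" if "x \<in> carrier ?L" for x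
    using quot_limit_extensional[OF that] by (simp add: extensional_restrict)
  have mclosed: "x \<otimes>\<^bsub>?L\<^esub> y \<in> carrier ?L" if "x \<in> carrier ?L" "y \<in> carrier ?L" for x y
    unfolding quot_limit_carrier_iff
    using that comp ring_hom_mult[OF hom] mem
    by (auto simp: quot_limit_simps intro!: monoid.m_closed ring.is_monoid rg)
  have aclosed: "x \<oplus>\<^bsub>?L\<^esub> y \<in> carrier ?L" if "x \<in> carrier ?L" "y \<in> carrier ?L" for x y
    unfolding quot_limit_carrier_iff
    using that comp ring_hom_add[OF hom] mem
    by (auto simp: quot_limit_simps intro!: ring.ring_simprules(1) rg)
  have oneclosed: "\<one>\<^bsub>?L\<^esub> \<in> carrier ?L"
    unfolding quot_limit_carrier_iff
    using ring_hom_one[OF hom]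
    by (auto simp: quot_limit_simps intro!: ring.ring_simprules(6) rg)
  have zeroclosed: "\<zero>\<^bsub>?L\<^esub> \<in> carrier ?L"
    unfolding quot_limit_carrier_iff
    using set_add_zero_Quot A
    by (auto simp: quot_limit_simps intro!: ring.ring_simprules(2) rg)
  have inv: "\<exists>y\<in>carrier ?L. y \<oplus>\<^bsub>?L\<^esub> x = \<zero>\<^bsub>?L\<^esub>" if x: "x \<in> carrier ?L" for x
  proof
    let ?y = "\<lambda>i\<in>I. \<ominus>\<^bsub>R Quot A i\<^esub> x i"
    show "?y \<in> carrier ?L"
      unfolding quot_limit_carrier_iff
      using x comp mem ring_hom_cring.hom_a_inv[OF ring_hom_cringI[OF cr cr hom]]
      by (auto intro!: ring.ring_simprules(3) rg)
    show "?y \<oplus>\<^bsub>?L\<^esub> x = \<zero>\<^bsub>?L\<^esub>"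
      using x mem by (simp add: quot_limit_simps ring.ring_simprules(9)[OF rg] cong: restrict_cong)
  qed
  show ?thesis
  proof (intro cringI abelian_groupI comm_monoidI)
    fix x y z assume x: "x \<in> carrier ?L" and y: "y \<in> carrier ?L" and z: "z \<in> carrier ?L"
    show "x \<oplus>\<^bsub>?L\<^esub> y \<oplus>\<^bsub>?L\<^esub> z = x \<oplus>\<^bsub>?L\<^esub> (y \<oplus>\<^bsub>?L\<^esub> z)"
      using x y z mem by (simp add: quot_limit_simps ring.ring_simprules(7)[OF rg] cong: restrict_cong)
    show "x \<otimes>\<^bsub>?L\<^esub> y \<otimes>\<^bsub>?L\<^esub> z = x \<otimes>\<^bsub>?L\<^esub> (y \<otimes>\<^bsub>?L\<^esub> z)"
      using x y z mem by (simp add: quot_limit_simps ring.ring_simprules(11)[OF rg] cong: restrict_cong)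
    show "(x \<oplus>\<^bsub>?L\<^esub> y) \<otimes>\<^bsub>?L\<^esub> z = x \<otimes>\<^bsub>?L\<^esub> z \<oplus>\<^bsub>?L\<^esub> y \<otimes>\<^bsub>?L\<^esub> z"
      using x y z mem by (simp add: quot_limit_simps ring.ring_simprules(13)[OF rg] cong: restrict_cong)
  next
    fix x y assume x: "x \<in> carrier ?L" and y: "y \<in> carrier ?L"
    show "x \<oplus>\<^bsub>?L\<^esub> y = y \<oplus>\<^bsub>?L\<^esub> x"
      using x y mem by (simp add: quot_limit_simps ring.ring_simprules(10)[OF rg, of _ "x _" "y _"] cong: restrict_cong)
    show "x \<otimes>\<^bsub>?L\<^esub> y = y \<otimes>\<^bsub>?L\<^esub> x"
      using x y mem by (simp add: quot_limit_simps cring.cring_simprules(14)[OF cr, of _ "x _" "y _"] cong: restrict_cong)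
  next
    fix x assume x: "x \<in> carrier ?L"
    show "\<zero>\<^bsub>?L\<^esub> \<oplus>\<^bsub>?L\<^esub> x = x"
      using x mem by (subst (2) ext[OF x]) (simp add: quot_limit_simps ring.ring_simprules(8)[OF rg] cong: restrict_cong)
    show "\<one>\<^bsub>?L\<^esub> \<otimes>\<^bsub>?L\<^esub> x = x"
      using x mem by (subst (2) ext[OF x]) (simp add: quot_limit_simps ring.ring_simprules(12)[OF rg] cong: restrict_cong)
  qed (use mclosed aclosed oneclosed zeroclosed inv in auto)
qed

lemma quot_limit_eval_ring_hom:
  assumes "i \<in> I"
  shows "(\<lambda>x. x i) \<in> ring_hom (quot_limit R I A) (R Quot A i)"
  using assms by (auto intro!: ring_hom_memI simp: quot_limit_simps quot_limit_in_Quot)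

section \<open>The ring \<open>Dhat\<close> and values of polynomials in it\<close>

lemma Dhat_carrier_iff:
  "x \<in> carrier (Dhat R) \<longleftrightarrow> x \<in> extensional (nonzero_ideals R) \<and>
     (\<forall>I\<in>nonzero_ideals R. x I \<in> carrier (R Quot I)) \<and>
     (\<forall>I\<in>nonzero_ideals R. \<forall>J\<in>nonzero_ideals R. I \<subseteq> J \<longrightarrow> x J = J <+> x I)"
  by (simp add: Dhat_def quot_limit_carrier_iff)

lemma Dhat_in_Quot: "\<lbrakk>x \<in> carrier (Dhat R); I \<in> nonzero_ideals R\<rbrakk> \<Longrightarrow> x I \<in> carrier (R Quot I)"
  unfolding Dhat_carrier_iff by blast

lemma Dhat_compat:
  "\<lbrakk>x \<in> carrier (Dhat R); I \<in> nonzero_ideals R; J \<in> nonzero_ideals R; I \<subseteq> J\<rbrakk> \<Longrightarrow> J <+> x I = x J"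
  unfolding Dhat_carrier_iff by metis

lemma Dhat_cring: "cring (Dhat R)"
  unfolding Dhat_def by (rule quot_limit_cring) (simp add: nonzero_ideals_def)

lemma Dhat_eval_ring_hom_cring:
  assumes "I \<in> nonzero_ideals R"
  shows "ring_hom_cring (Dhat R) (R Quot I) (\<lambda>x. x I)"
proof (rule ring_hom_cringI)
  show "(\<lambda>x. x I) \<in> ring_hom (Dhat R) (R Quot I)"
    unfolding Dhat_def using quot_limit_eval_ring_hom[OF assms, of "\<lambda>a. a"] by simp
  show "cring (R Quot I)"
    using assms by (intro ideal.quotient_is_cring is_cring) (simp add: nonzero_ideals_def)
qed (rule Dhat_cring)

lemma Dhat_embed_closed:
  assumes "r \<in> carrier R"
  shows "Dhat_embed R r \<in> carrier (Dhat R)"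
  unfolding Dhat_carrier_iff Dhat_embed_def
  using assms set_add_a_rcos by (auto intro: a_rcos_in_Quot simp: nonzero_ideals_def)

lemma Dhat_embed_apply: "I \<in> nonzero_ideals R \<Longrightarrow> Dhat_embed R r I = I +> r"
  by (simp add: Dhat_embed_def)

lemma Dhat_poly_eval_closed:
  assumes "p \<in> carrier (UP R)" "a \<in> carrier (Dhat R)"
  shows "UnivPoly.eval R (Dhat R) (Dhat_embed R) a p \<in> carrier (Dhat R)"
proof -
  interpret L: cring "Dhat R" by (rule Dhat_cring)
  interpret U: UP_cring R "UP R" by unfold_locales
  show ?thesis
    unfolding UnivPoly.eval_def using assms U.coeff_closed Dhat_embed_closed
    by (auto intro!: L.finsum_closed)
qed

text \<open>Projection to \<open>R Quot I\<close> is a ring homomorphism, so it turns the value of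
  \<open>p\<close> into the value of the reduced polynomial at \<open>a I\<close>. Applied to prime
  powers, this keeps the preimage under a polynomial map a condition prime by prime.\<close>

lemma Dhat_poly_eval_cong:
  assumes p: "p \<in> carrier (UP R)" and a: "a \<in> carrier (Dhat R)" and b: "b \<in> carrier (Dhat R)"
    and I: "I \<in> nonzero_ideals R" and ab: "a I = b I"
  shows "UnivPoly.eval R (Dhat R) (Dhat_embed R) a p I = UnivPoly.eval R (Dhat R) (Dhat_embed R) b p I"
proof -
  interpret L: cring "Dhat R" by (rule Dhat_cring)
  interpret U: UP_cring R "UP R" by unfold_locales
  interpret h: ring_hom_cring "Dhat R" "R Quot I" "\<lambda>x. x I"
    using I by (rule Dhat_eval_ring_hom_cring)
  have *: "UnivPoly.eval R (Dhat R) (Dhat_embed R) c p I =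
    (\<Oplus>\<^bsub>R Quot I\<^esub>i \<in> {..deg R p}. Dhat_embed R (up_ring.coeff (UP R) p i) I \<otimes>\<^bsub>R Quot I\<^esub> c I [^]\<^bsub>R Quot I\<^esub> i)"
    if "c \<in> carrier (Dhat R)" for c
  proof -
    have "(\<lambda>i. Dhat_embed R (up_ring.coeff (UP R) p i) \<otimes>\<^bsub>Dhat R\<^esub> c [^]\<^bsub>Dhat R\<^esub> i) \<in> {..deg R p} \<rightarrow> carrier (Dhat R)"
      using p that U.coeff_closed Dhat_embed_closed by auto
    then show ?thesis
      using p that U.coeff_closed Dhat_embed_closed
      unfolding UnivPoly.eval_def by (simp add: h.hom_finsum comp_def cong: h.S.finsum_cong)
  qed
  show ?thesis
    using *[OF a] *[OF b] ab by simp
qed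

end

section \<open>Gluing and equinumerous fibres\<close>

text \<open>A map with equinumerous fibres carries the uniform distribution on \<open>A\<close> to
  that on its image: the common fibre size \<open>m\<close> cancels.\<close>

lemma average_over_equal_fibres:
  fixes \<psi> :: "'c \<Rightarrow> 'b :: field_char_0"
  assumes fin: "finite A"
    and eq: "\<And>b b'. \<lbrakk>b \<in> f ` A; b' \<in> f ` A\<rbrakk> \<Longrightarrow> card {a \<in> A. f a = b} = card {a \<in> A. f a = b'}"
  shows "(\<Sum>a\<in>A. \<psi> (f a)) / of_nat (card A) = (\<Sum>b\<in>f ` A. \<psi> b) / of_nat (card (f ` A))"
proof (cases "A = {}")
  case False
  then obtain a0 where a0: "a0 \<in> A" by auto
  define m where "m = card {a \<in> A. f a = f a0}"
  have m: "card {a \<in> A. f a = b} = m" if "b \<in> f ` A" for b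
    unfolding m_def using that a0 by (intro eq) auto
  have m0: "m \<noteq> 0"
    unfolding m_def using a0 fin by (auto simp: card_eq_0_iff)
  have "(\<Sum>a\<in>A. \<psi> (f a)) = (\<Sum>b\<in>f ` A. \<Sum>a\<in>{a \<in> A. f a = b}. \<psi> (f a))"
    by (rule sum.image_gen[OF fin])
  also have "\<dots> = (\<Sum>b\<in>f ` A. of_nat m * \<psi> b)"
    by (rule sum.cong) (auto simp: m[symmetric])
  finally have 1: "(\<Sum>a\<in>A. \<psi> (f a)) = of_nat m * (\<Sum>b\<in>f ` A. \<psi> b)"
    by (simp add: sum_distrib_left)
  have "card A = (\<Sum>b\<in>f ` A. \<Sum>a\<in>{a \<in> A. f a = b}. 1)"
    unfolding card_eq_sum by (rule sum.image_gen[OF fin])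
  also have "\<dots> = card (f ` A) * m"
    using m by simp
  finally have 2: "card A = card (f ` A) * m" .
  show ?thesis
    unfolding 1 2 using m0 by simp
qed simp

section \<open>Elements of \<open>Dhat\<close> prime by prime\<close>

context finite_quotient_domain
begin

lemma Dhat_coset:
  assumes "x \<in> carrier (Dhat R)" "I \<in> nonzero_ideals R"
  obtains r where "r \<in> carrier R" "x I = I +> r"
  using Dhat_in_Quot[OF assms] by (rule Quot_cases)

lemma Dhat_coset_superset:
  assumes "x \<in> carrier (Dhat R)" "I \<in> nonzero_ideals R" "J \<in> nonzero_ideals R" "I \<subseteq> J"
    and "r \<in> carrier R" "x I = I +> r"
  shows "x J = J +> r"
  using Dhat_compat[OF assms(1-4)] set_add_a_rcos[OF nonzero_idealD nonzero_idealD, of I J r] assms by simp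

lemma Dhat_eq_superset:
  assumes "x \<in> carrier (Dhat R)" "y \<in> carrier (Dhat R)" "I \<in> nonzero_ideals R" "J \<in> nonzero_ideals R"
    and "I \<subseteq> J" "x I = y I"
  shows "x J = y J"
  using Dhat_compat[of x I J] Dhat_compat[of y I J] assms by metis

lemma prime_power_nonzero: "P \<in> nonzero_primes R \<Longrightarrow> ideal_power R P n \<in> nonzero_ideals R"
  by (intro ideal_power_nonzero nonzero_prime_nonzero_ideal)

lemma prime_power_meet_le: "P \<in> T \<Longrightarrow> prime_power_meet T n \<subseteq> ideal_power R P n"
  by (auto simp: prime_power_meet_def)

lemma prime_power_antimono:
  "\<lbrakk>P \<in> nonzero_primes R; m \<le> n\<rbrakk> \<Longrightarrow> ideal_power R P n \<subseteq> ideal_power R P m"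
  by (intro ideal_power_antimono nonzero_primeD)

lemma a_rcos_eq_iff:
  "\<lbrakk>I \<in> nonzero_ideals R; r \<in> carrier R; s \<in> carrier R\<rbrakk> \<Longrightarrow> I +> r = I +> s \<longleftrightarrow> r \<ominus> s \<in> I"
  using quotient_eq_iff_same_a_r_cos[OF nonzero_idealD] by metis

lemma a_rcos_eq_superset:
  "\<lbrakk>I \<in> nonzero_ideals R; J \<in> nonzero_ideals R; I \<subseteq> J; r \<in> carrier R; s \<in> carrier R; I +> r = I +> s\<rbrakk>
    \<Longrightarrow> J +> r = J +> s"
  by (auto simp: a_rcos_eq_iff)

lemma a_rcos_eq_prime_power_meet:
  assumes T: "finite T" "T \<subseteq> nonzero_primes R" and rs: "r \<in> carrier R" "s \<in> carrier R"
    and eq: "\<And>P. P \<in> T \<Longrightarrow> ideal_power R P n +> r = ideal_power R P n +> s"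
  shows "prime_power_meet T n +> r = prime_power_meet T n +> s"
proof -
  have "r \<ominus> s \<in> ideal_power R P n" if "P \<in> T" for P
    using eq[OF that] a_rcos_eq_iff[OF prime_power_nonzero rs, of P n] T that by auto
  then have "r \<ominus> s \<in> prime_power_meet T n"
    using rs by (auto simp: prime_power_meet_def)
  then show ?thesis
    using a_rcos_eq_iff[OF prime_power_meet_nonzero[OF T] rs] by simp
qed

text \<open>The meet is the kernel of the map from \<open>R\<close> to the product of its quotients
  by the prime powers, so residues modulo those powers determine the residue modulo the
  meet.\<close>

lemma Dhat_eq_if_eq_at_primes:
  assumes x: "x \<in> carrier (Dhat R)" and y: "y \<in> carrier (Dhat R)"
    and T: "finite T" "T \<subseteq> nonzero_primes R"
    and I: "I \<in> nonzero_ideals R" "prime_power_meet T n \<subseteq> I"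
    and eq: "\<And>P. P \<in> T \<Longrightarrow> x (ideal_power R P n) = y (ideal_power R P n)"
  shows "x I = y I"
proof -
  let ?m = "prime_power_meet T n"
  have m: "?m \<in> nonzero_ideals R" using T by (rule prime_power_meet_nonzero)
  obtain r where r: "r \<in> carrier R" "x ?m = ?m +> r" using x m by (rule Dhat_coset)
  obtain s where s: "s \<in> carrier R" "y ?m = ?m +> s" using y m by (rule Dhat_coset)
  have "ideal_power R P n +> r = ideal_power R P n +> s" if "P \<in> T" for P
  proof -
    have P: "ideal_power R P n \<in> nonzero_ideals R" using T that by (intro prime_power_nonzero) auto
    show ?thesis
      using Dhat_coset_superset[OF x m P prime_power_meet_le[OF that] r]
        Dhat_coset_superset[OF y m P prime_power_meet_le[OF that] s] eq[OF that] by simp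
  qed
  then have "x ?m = y ?m"
    using a_rcos_eq_prime_power_meet[OF T r(1) s(1)] r s by simp
  then show ?thesis
    using Dhat_eq_superset[OF x y m I] by simp
qed

text \<open>Injectivity of the map from \<open>Dhat\<close> to the product of the local completions;
  it holds because meets of prime powers are cofinal among the non-zero ideals.\<close>

lemma Dhat_ext_primes:
  assumes x: "x \<in> carrier (Dhat R)" and y: "y \<in> carrier (Dhat R)"
    and eq: "\<And>P n. P \<in> nonzero_primes R \<Longrightarrow> x (ideal_power R P n) = y (ideal_power R P n)"
  shows "x = y"
proof
  fix I
  show "x I = y I"
  proof (cases "I \<in> nonzero_ideals R")
    case True
    obtain T n where "finite T" "T \<subseteq> nonzero_primes R" "prime_power_meet T n \<subseteq> I"
      using prime_power_meet_subset_nonzero_ideal[OF True] by blast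
    then show ?thesis
      using Dhat_eq_if_eq_at_primes[OF x y _ _ True] eq by blast
  next
    case False
    then show ?thesis
      using x y unfolding Dhat_carrier_iff extensional_def by simp
  qed
qed

lemma prime_power_residues:
  assumes T: "finite T" "T \<subseteq> nonzero_primes R"
    and y: "\<And>P. P \<in> T \<Longrightarrow> y P \<in> carrier (R Quot ideal_power R P n)"
  shows "\<exists>r\<in>carrier R. \<forall>P\<in>T. y P = ideal_power R P n +> r"
proof -
  have "\<exists>s. s \<in> carrier R \<and> y P = ideal_power R P n +> s" if "P \<in> T" for P
    using y[OF that] by (rule Quot_cases) auto
  then obtain s where s: "\<And>P. P \<in> T \<Longrightarrow> s P \<in> carrier R \<and> y P = ideal_power R P n +> s P"
    by metis
  have "\<exists>r\<in>carrier R. \<forall>P\<in>T. r \<ominus> s P \<in> ideal_power R P n"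
    using T s by (intro chinese_remainder_elements ideal_power_ideal nonzero_primes_comaximal)
      (auto intro: nonzero_primeD)
  then obtain r where r: "r \<in> carrier R" "\<forall>P\<in>T. r \<ominus> s P \<in> ideal_power R P n" by auto
  have "y P = ideal_power R P n +> r" if "P \<in> T" for P
    using r s[OF that] that a_rcos_eq_iff[OF prime_power_nonzero, of P r "s P" n] T by auto
  then show ?thesis using r by auto
qed

text \<open>The components are prescribed by elements of \<open>Dhat\<close> rather than of the
  local completions: in the application they always come from elements already at hand.\<close>

lemma Dhat_glue:
  assumes y: "\<And>P. P \<in> nonzero_primes R \<Longrightarrow> y P \<in> carrier (Dhat R)"
  shows "\<exists>z\<in>carrier (Dhat R). \<forall>P\<in>nonzero_primes R. \<forall>n. z (ideal_power R P n) = y P (ideal_power R P n)"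
proof -
  \<comment> \<open>\<open>sol T n r\<close> means that \<open>r\<close> approximates
    \<open>y P\<close> to precision \<open>n\<close> at the primes of \<open>T\<close>;
    \<open>E I r\<close> adds that this precision fixes the residue modulo \<open>I\<close>.\<close>
  define sol where "sol T n r \<longleftrightarrow> finite T \<and> T \<subseteq> nonzero_primes R \<and> r \<in> carrier R \<and>
      (\<forall>P\<in>T. y P (ideal_power R P n) = ideal_power R P n +> r)" for T n r
  define E where "E I r \<longleftrightarrow> (\<exists>T n. sol T n r \<and> prime_power_meet T n \<subseteq> I)" for I r
  have sol_ex: "\<exists>r. sol T n r" if "finite T" "T \<subseteq> nonzero_primes R" for T n
  proof -
    have "y P (ideal_power R P n) \<in> carrier (R Quot ideal_power R P n)" if "P \<in> T" for P
      using that \<open>T \<subseteq> nonzero_primes R\<close> by (intro Dhat_in_Quot y prime_power_nonzero) auto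
    then have "\<exists>r\<in>carrier R. \<forall>P\<in>T. y P (ideal_power R P n) = ideal_power R P n +> r"
      by (rule prime_power_residues[OF that])
    then show ?thesis
      using that unfolding sol_def by auto
  qed
  have E_ex: "\<exists>r. E I r" if "I \<in> nonzero_ideals R" for I
  proof -
    obtain T n where T: "finite T" "T \<subseteq> nonzero_primes R" "prime_power_meet T n \<subseteq> I"
      using prime_power_meet_subset_nonzero_ideal[OF \<open>I \<in> nonzero_ideals R\<close>] by auto
    obtain r where "sol T n r" using sol_ex[OF T(1,2)] by auto
    with T(3) show ?thesis unfolding E_def by (intro exI conjI)
  qed
  have E_carrier: "r \<in> carrier R" if "E I r" for I r
    using that by (auto simp: E_def sol_def)
  \<comment> \<open>A finer approximation is also a coarser one. Two unrelated approximations are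
    then compared through one for the union of their primes and the larger exponent.\<close>
  have sol_unique: "I +> r = I +> r'"
    if I: "I \<in> nonzero_ideals R" and 1: "sol T n r" "prime_power_meet T n \<subseteq> I"
      and 2: "sol T' n' r'" "T \<subseteq> T'" "n \<le> n'" for I T n r T' n' r'
  proof -
    have T: "finite T" "T \<subseteq> nonzero_primes R" and r: "r \<in> carrier R" "r' \<in> carrier R"
      using 1 2 by (auto simp: sol_def)
    have "ideal_power R P n +> r = ideal_power R P n +> r'" if P: "P \<in> T" for P
    proof -
      have PP: "P \<in> nonzero_primes R" using T P by auto
      have "y P (ideal_power R P n') = ideal_power R P n' +> r'"
        using 2 P by (auto simp: sol_def)
      then have "y P (ideal_power R P n) = ideal_power R P n +> r'"
        using Dhat_coset_superset[OF y[OF PP] prime_power_nonzero[OF PP] prime_power_nonzero[OF PP]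
          prime_power_antimono[OF PP 2(3)] r(2)] by simp
      then show ?thesis using 1 P by (auto simp: sol_def)
    qed
    then have "prime_power_meet T n +> r = prime_power_meet T n +> r'"
      by (rule a_rcos_eq_prime_power_meet[OF T r])
    then show ?thesis
      using a_rcos_eq_superset[OF prime_power_meet_nonzero[OF T] I 1(2) r] by simp
  qed
  have E_unique: "I +> r = I +> r'" if I: "I \<in> nonzero_ideals R" and E: "E I r" "E I r'" for I r r'
  proof -
    obtain T n T' n' where 1: "sol T n r" "prime_power_meet T n \<subseteq> I"
      and 2: "sol T' n' r'" "prime_power_meet T' n' \<subseteq> I"
      using E by (auto simp: E_def)
    then have "finite (T \<union> T')" "T \<union> T' \<subseteq> nonzero_primes R" by (auto simp: sol_def)
    then obtain r'' where r'': "sol (T \<union> T') (max n n') r''" using sol_ex by blast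
    show ?thesis
      using sol_unique[OF I 1 r''] sol_unique[OF I 2 r''] by simp
  qed
  \<comment> \<open>The representatives are chosen separately for each ideal. Uniqueness makes the
    cosets independent of the choice, and an approximation good for \<open>I\<close> is good for
    every larger ideal; hence \<open>z\<close> is compatible.\<close>
  define \<rho> where "\<rho> I = (SOME r. E I r)" for I
  have \<rho>: "E I (\<rho> I)" if "I \<in> nonzero_ideals R" for I
    unfolding \<rho>_def using E_ex[OF that] by (rule someI_ex)
  define z where "z = (\<lambda>I\<in>nonzero_ideals R. I +> \<rho> I)"
  have z: "z I = I +> r" if "I \<in> nonzero_ideals R" "E I r" for I r
    using that E_unique[OF that(1) \<rho>[OF that(1)] that(2)] by (simp add: z_def)
  have "z \<in> carrier (Dhat R)"
    unfolding Dhat_carrier_iff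
  proof (intro conjI ballI impI)
    fix I J assume I: "I \<in> nonzero_ideals R" and J: "J \<in> nonzero_ideals R" and IJ: "I \<subseteq> J"
    have "E J (\<rho> I)" using \<rho>[OF I] IJ unfolding E_def by (meson subset_trans)
    then have "z J = J +> \<rho> I" using z[OF J] by simp
    also have "\<dots> = J <+> (I +> \<rho> I)"
      using set_add_a_rcos[OF nonzero_idealD[OF I] nonzero_idealD[OF J] IJ] E_carrier[OF \<rho>[OF I]] by simp
    finally show "z J = J <+> z I" using I by (simp add: z_def)
  qed (auto simp: z_def intro: a_rcos_in_Quot E_carrier \<rho>)
  moreover have "z (ideal_power R P n) = y P (ideal_power R P n)" if P: "P \<in> nonzero_primes R" for P n
  proof -
    have Pn: "ideal_power R P n \<in> nonzero_ideals R" using P by (rule prime_power_nonzero)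
    obtain r where r: "r \<in> carrier R" "y P (ideal_power R P n) = ideal_power R P n +> r"
      using y[OF P] Pn by (rule Dhat_coset)
    have "sol {P} n r" using r P by (simp add: sol_def)
    then have "E (ideal_power R P n) r"
      using prime_power_meet_le[of P "{P}" n] unfolding E_def by (intro exI conjI) auto
    then show ?thesis using z[OF Pn] r by simp
  qed
  ultimately show ?thesis by blast
qed

lemma Dhat_add_apply:
  "I \<in> nonzero_ideals R \<Longrightarrow> (x \<oplus>\<^bsub>Dhat R\<^esub> y) I = x I <+> y I"
  by (simp add: Dhat_def quot_limit_simps FactRing_def)

lemma Dhat_add_embed_apply:
  assumes I: "I \<in> nonzero_ideals R" and "r \<in> carrier R" "x I = I +> r" "t \<in> carrier R"
  shows "(x \<oplus>\<^bsub>Dhat R\<^esub> Dhat_embed R t) I = I +> (r \<oplus> t)"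
  using assms by (simp add: Dhat_add_apply Dhat_embed_apply ideal.a_rcos_sum[OF nonzero_idealD[OF I]])

text \<open>The core of the argument, for arbitrary conditions \<open>Q P\<close>, each decided by
  the residue modulo some power of \<open>P\<close>. By symmetry in \<open>c\<close> and
  \<open>d\<close> it is enough to inject one fibre into the other.\<close>

lemma prime_local_fibre_card:
  assumes loc: "\<And>P. P \<in> nonzero_primes R \<Longrightarrow> \<exists>n. \<forall>x\<in>carrier (Dhat R). \<forall>y\<in>carrier (Dhat R).
        x (ideal_power R P n) = y (ideal_power R P n) \<longrightarrow> Q P x \<longrightarrow> Q P y"
    and Z: "Z = {x \<in> carrier (Dhat R). \<forall>P\<in>nonzero_primes R. Q P x}"
    and B: "B \<in> nonzero_ideals R"
  shows "\<exists>E\<in>nonzero_ideals R. E \<subseteq> B \<and> (\<forall>A\<in>nonzero_ideals R. A \<subseteq> E \<longrightarrow>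
     (\<forall>c\<in>(\<lambda>x. x E) ` Z. \<forall>d\<in>(\<lambda>x. x E) ` Z.
       card {u \<in> (\<lambda>x. x A) ` Z. E <+> u = c} = card {u \<in> (\<lambda>x. x A) ` Z. E <+> u = d}))"
proof -
  obtain lev where lev: "Q P y"
    if "P \<in> nonzero_primes R" "x \<in> carrier (Dhat R)" "y \<in> carrier (Dhat R)"
      "x (ideal_power R P (lev P)) = y (ideal_power R P (lev P))" "Q P x" for P x y
    using loc by metis
  obtain T n where T: "finite T" "T \<subseteq> nonzero_primes R" and TB: "prime_power_meet T n \<subseteq> B"
    using prime_power_meet_subset_nonzero_ideal[OF B] by blast
  \<comment> \<open>The bound \<open>n\<close> ensures \<open>E \<subseteq> B\<close>; the levels
    ensure that the residue modulo \<open>E\<close> decides the conditions at all primes of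
    \<open>T\<close>.\<close>
  define N where "N = Max (insert n (lev ` T))"
  have N: "n \<le> N" "\<And>P. P \<in> T \<Longrightarrow> lev P \<le> N"
    using T by (auto simp: N_def)
  define E where "E = prime_power_meet T N"
  have E: "E \<in> nonzero_ideals R" unfolding E_def by (rule prime_power_meet_nonzero[OF T])
  have EB: "E \<subseteq> B"
    unfolding E_def using prime_power_meet_antimono[OF T(2) subset_refl N(1)] TB by auto
  have le: "card {u \<in> (\<lambda>x. x A) ` Z. E <+> u = c} \<le> card {u \<in> (\<lambda>x. x A) ` Z. E <+> u = d}"
    if A: "A \<in> nonzero_ideals R" "A \<subseteq> E" and c: "c \<in> (\<lambda>x. x E) ` Z" and d: "d \<in> (\<lambda>x. x E) ` Z"
    for A c d
  proof -
    obtain z1 where z1: "z1 \<in> Z" "c = z1 E" using c by auto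
    obtain z2 where z2: "z2 \<in> Z" "d = z2 E" using d by auto
    have z1c: "z1 \<in> carrier (Dhat R)" and z2c: "z2 \<in> carrier (Dhat R)" using z1 z2 Z by auto
    obtain U0 m0 where U0: "finite U0" "U0 \<subseteq> nonzero_primes R" "prime_power_meet U0 m0 \<subseteq> A"
      using prime_power_meet_subset_nonzero_ideal[OF A(1)] by blast
    \<comment> \<open>\<open>A\<close> is arbitrary below \<open>E\<close>, so it is approximated
      from inside by a meet over more primes and to a higher exponent; the translation is built at
      this precision.\<close>
    define U where "U = U0 \<union> T"
    define m where "m = max m0 N"
    have U: "finite U" "U \<subseteq> nonzero_primes R" "T \<subseteq> U" "N \<le> m"
      using U0 T by (auto simp: U_def m_def)
    have UA: "prime_power_meet U m \<subseteq> A"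
      using prime_power_meet_antimono[OF U(2), of U0 m0 m] U0 by (auto simp: U_def m_def)
    define \<rho> where
      "\<rho> z P = (SOME r. r \<in> carrier R \<and> z (ideal_power R P m) = ideal_power R P m +> r)" for z P
    have "\<rho> z P \<in> carrier R \<and> z (ideal_power R P m) = ideal_power R P m +> \<rho> z P"
      if "P \<in> T" "z \<in> carrier (Dhat R)" for P z
      unfolding \<rho>_def by (rule someI_ex, rule Dhat_coset[OF that(2) prime_power_nonzero]) (use that T in auto)
    then have \<rho>: "\<rho> z P \<in> carrier R" "z (ideal_power R P m) = ideal_power R P m +> \<rho> z P"
      if "P \<in> T" "z \<in> carrier (Dhat R)" for P z
      using that by auto
    have "\<exists>t\<in>carrier R. \<forall>P\<in>U. t \<ominus> (if P \<in> T then \<rho> z2 P \<ominus> \<rho> z1 P else \<zero>) \<in> ideal_power R P m"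
      using U \<rho> z1c z2c
      by (intro chinese_remainder_elements ideal_power_ideal nonzero_primes_comaximal)
        (auto intro: nonzero_primeD)
    then obtain t where t: "t \<in> carrier R"
      "\<And>P. P \<in> T \<Longrightarrow> t \<ominus> (\<rho> z2 P \<ominus> \<rho> z1 P) \<in> ideal_power R P m"
      "\<And>P. \<lbrakk>P \<in> U; P \<notin> T\<rbrakk> \<Longrightarrow> t \<in> ideal_power R P m"
      using U(3) by (auto simp: minus_eq subset_iff split: if_splits)
    interpret QA: ring "R Quot A" using A nonzero_idealD by (intro ideal.quotient_is_ring) auto
    \<comment> \<open>\<open>t\<close> depends on \<open>z1\<close> and \<open>z2\<close> but not on
      the point of the fibre, so \<open>h\<close> is a single translation and its injectivity is
      cancellation.\<close>
    define h where "h u = u <+> (A +> t)" for u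
    have h_add: "h u = u \<oplus>\<^bsub>R Quot A\<^esub> (A +> t)" for u
      by (simp add: h_def FactRing_def)
    have tA: "A +> t \<in> carrier (R Quot A)" using t by (intro a_rcos_in_Quot)
    have ZQ: "(\<lambda>x. x A) ` Z \<subseteq> carrier (R Quot A)"
      using Dhat_in_Quot A Z by auto
    have fin: "finite ((\<lambda>x. x A) ` Z)"
      using ZQ finite_Quot[OF A(1)] by (rule finite_subset)
    \<comment> \<open>\<open>t\<close> moves the \<open>T\<close>-component of \<open>z1\<close> to that of \<open>z2\<close> and vanishes modulo \<open>A\<close> at all other
      primes. Adding \<open>t\<close> at the primes in \<open>T\<close> only therefore preserves \<open>Z\<close>, and modulo \<open>A\<close> it
      is the translation by \<open>t\<close>.\<close>
    show ?thesis
    proof (rule card_inj_on_le)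
      show "inj_on h {u \<in> (\<lambda>x. x A) ` Z. E <+> u = c}"
      proof (rule inj_onI)
        fix u v
        assume "u \<in> {u \<in> (\<lambda>x. x A) ` Z. E <+> u = c}" "v \<in> {u \<in> (\<lambda>x. x A) ` Z. E <+> u = c}"
        then have "u \<in> carrier (R Quot A)" "v \<in> carrier (R Quot A)"
          using ZQ by blast+
        moreover assume "h u = h v"
        ultimately show "u = v"
          unfolding h_add using QA.add.right_cancel[OF tA] by simp
      qed
      show "finite {u \<in> (\<lambda>x. x A) ` Z. E <+> u = d}"
        using fin by simp
      show "h ` {u \<in> (\<lambda>x. x A) ` Z. E <+> u = c} \<subseteq> {u \<in> (\<lambda>x. x A) ` Z. E <+> u = d}"
      proof clarify
        fix z assume z: "z \<in> Z" and zE: "c = E <+> z A"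
        have zc: "z \<in> carrier (Dhat R)" using z Z by auto
        have zE1: "z E = z1 E" using zE z1 Dhat_compat[OF zc A(1) E A(2)] by simp
        interpret L: cring "Dhat R" by (rule Dhat_cring)
        \<comment> \<open>\<open>w\<close> itself may leave \<open>Z\<close>, because
          \<open>t\<close> is uncontrolled at the primes outside \<open>U\<close>. The glued
          \<open>z'\<close> keeps \<open>z\<close> at all primes outside \<open>T\<close>; modulo
          \<open>A\<close> only the primes of \<open>U\<close> are visible, and there
          \<open>z'\<close> and \<open>w\<close> agree.\<close>
        define w where "w = z \<oplus>\<^bsub>Dhat R\<^esub> Dhat_embed R t"
        have wc: "w \<in> carrier (Dhat R)" using zc t Dhat_embed_closed by (simp add: w_def)
        have "\<exists>z'\<in>carrier (Dhat R). \<forall>P\<in>nonzero_primes R. \<forall>n.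
           z' (ideal_power R P n) = (if P \<in> T then w else z) (ideal_power R P n)"
          by (rule Dhat_glue) (use wc zc in auto)
        then obtain z' where z'c: "z' \<in> carrier (Dhat R)"
          and z': "\<forall>P\<in>nonzero_primes R. \<forall>n.
            z' (ideal_power R P n) = (if P \<in> T then w else z) (ideal_power R P n)"
          by blast
        have z'T: "z' (ideal_power R P n) = w (ideal_power R P n)" if "P \<in> T" for P n
          using bspec[OF z' subsetD[OF T(2) that]] that by simp
        have z'nT: "z' (ideal_power R P n) = z (ideal_power R P n)"
          if "P \<in> nonzero_primes R" "P \<notin> T" for P n
          using bspec[OF z' that(1)] that by simp
        \<comment> \<open>The precision drops from \<open>m\<close> to \<open>N\<close>, since
          \<open>z\<close> and \<open>z1\<close> are only known to agree modulo \<open>E\<close>.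
          This still reaches \<open>lev P\<close>.\<close>
        have z'2: "z' (ideal_power R P N) = z2 (ideal_power R P N)" if P: "P \<in> T" for P
        proof -
          let ?I = "ideal_power R P m" and ?J = "ideal_power R P N"
          have PP: "P \<in> nonzero_primes R" using P T by auto
          have I: "?I \<in> nonzero_ideals R" and J: "?J \<in> nonzero_ideals R" and IJ: "?I \<subseteq> ?J"
            using PP U(4) prime_power_nonzero prime_power_antimono by auto
          note c = \<rho>(1)[OF P zc] \<rho>(1)[OF P z1c] \<rho>(1)[OF P z2c] t(1)
          interpret J: ideal ?J R using J by (rule nonzero_idealD)
          note J1 = Dhat_coset_superset[OF zc I J IJ \<rho>[OF P zc]]
            and J2 = Dhat_coset_superset[OF z1c I J IJ \<rho>[OF P z1c]]
            and J3 = Dhat_coset_superset[OF z2c I J IJ \<rho>[OF P z2c]]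
          have "z ?J = z1 ?J"
            using Dhat_eq_superset[OF zc z1c E J _ zE1] prime_power_meet_le[OF P] by (simp add: E_def)
          then have 1: "\<rho> z P \<ominus> \<rho> z1 P \<in> ?J"
            using a_rcos_eq_iff[OF J c(1,2)] J1 J2 by simp
          have 2: "t \<ominus> (\<rho> z2 P \<ominus> \<rho> z1 P) \<in> ?J"
            using t(2)[OF P] IJ by auto
          have "(\<rho> z P \<oplus> t) \<ominus> \<rho> z2 P = (\<rho> z P \<ominus> \<rho> z1 P) \<oplus> (t \<ominus> (\<rho> z2 P \<ominus> \<rho> z1 P))"
            using c by algebra
          then have "(\<rho> z P \<oplus> t) \<ominus> \<rho> z2 P \<in> ?J"
            using 1 2 by simp
          then have "?J +> (\<rho> z P \<oplus> t) = ?J +> \<rho> z2 P"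
            using a_rcos_eq_iff[OF J, of "\<rho> z P \<oplus> t" "\<rho> z2 P"] c by simp
          moreover have "w ?J = ?J +> (\<rho> z P \<oplus> t)"
            unfolding w_def by (rule Dhat_add_embed_apply[where x = z, OF J c(1) J1 c(4)])
          ultimately show ?thesis
            using z'T[OF P] J3 by simp
        qed
        have "z' \<in> Z"
          unfolding Z
        proof (intro CollectI conjI ballI)
          fix P assume P: "P \<in> nonzero_primes R"
          show "Q P z'"
          proof (cases "P \<in> T")
            case True
            have "z2 (ideal_power R P (lev P)) = z' (ideal_power R P (lev P))"
              using Dhat_eq_superset[OF z'c z2c prime_power_nonzero[OF P] prime_power_nonzero[OF P]
                prime_power_antimono[OF P N(2)[OF True]] z'2[OF True]] by simp
            then show ?thesis
              using lev[OF P z2c z'c] z2 Z P by auto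
          next
            case False
            then show ?thesis
              using lev[OF P zc z'c] z'nT[OF P False] z Z P by auto
          qed
        qed (rule z'c)
        moreover have "z' A = h (z A)"
        proof -
          have "z' A = w A"
          proof (rule Dhat_eq_if_eq_at_primes[OF z'c wc U(1,2) A(1) UA])
            fix P assume P: "P \<in> U"
            let ?I = "ideal_power R P m"
            have PP: "P \<in> nonzero_primes R" using P U by auto
            have I: "?I \<in> nonzero_ideals R" using PP by (rule prime_power_nonzero)
            show "z' ?I = w ?I"
            proof (cases "P \<in> T")
              case True
              then show ?thesis by (rule z'T)
            next
              case False
              obtain r where r: "r \<in> carrier R" "z ?I = ?I +> r" using zc I by (rule Dhat_coset)
              have "w ?I = ?I +> (r \<oplus> t)"
                unfolding w_def by (rule Dhat_add_embed_apply[where x = z, OF I r t(1)])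
              moreover have "(r \<oplus> t) \<ominus> r = t" using r t(1) by algebra
              ultimately have "w ?I = ?I +> r"
                using a_rcos_eq_iff[OF I, of "r \<oplus> t" r] r t(1) t(3)[OF P False] by simp
              then show ?thesis using r z'nT[OF PP False] by simp
            qed
          qed
          then show ?thesis
            using A by (simp add: w_def h_def Dhat_add_apply Dhat_embed_apply)
        qed
        moreover have "E <+> z' A = d"
        proof -
          have "E <+> z' A = z' E" using Dhat_compat[OF z'c A(1) E A(2)] .
          also have "\<dots> = z2 E"
            by (rule Dhat_eq_if_eq_at_primes[OF z'c z2c T E _ z'2]) (simp_all add: E_def)
          finally show ?thesis using z2 by simp
        qed
        ultimately show "h (z A) \<in> (\<lambda>x. x A) ` Z \<and> E <+> h (z A) = d"
          by (metis imageI)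
      qed
    qed
  qed
  show ?thesis
    using E EB le by (intro bexI[of _ E]) (auto intro!: order.antisym)
qed

end

section \<open>Topology of inverse limits\<close>

text \<open>A Lebesgue number argument: the fibres through the points form an open cover, and
  \<open>dir\<close> dominates the levels of a finite subcover by one. The abstract projections
  \<open>pr\<close> allow its use both for \<open>Dhat\<close> and for powers of inverse
  limits.\<close>

lemma compact_space_uniform_level:
  assumes T: "compact_space T"
    and dir: "\<And>K. \<lbrakk>finite K; K \<subseteq> I\<rbrakk> \<Longrightarrow>
      \<exists>i\<in>I. \<forall>j\<in>K. \<forall>x\<in>topspace T. \<forall>y\<in>topspace T. pr i x = pr i y \<longrightarrow> pr j x = pr j y"
    and op: "\<And>i c. i \<in> I \<Longrightarrow> openin T {x \<in> topspace T. pr i x = c}"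
    and loc: "\<And>x. x \<in> topspace T \<Longrightarrow> \<exists>i\<in>I. \<forall>y\<in>topspace T. pr i y = pr i x \<longrightarrow> \<phi> y = \<phi> x"
  shows "\<exists>i\<in>I. \<forall>x\<in>topspace T. \<forall>y\<in>topspace T. pr i x = pr i y \<longrightarrow> \<phi> x = \<phi> y"
proof -
  obtain l where l: "\<And>x. x \<in> topspace T \<Longrightarrow> l x \<in> I"
    "\<And>x y. \<lbrakk>x \<in> topspace T; y \<in> topspace T; pr (l x) y = pr (l x) x\<rbrakk> \<Longrightarrow> \<phi> y = \<phi> x"
    using loc by metis
  define N where "N x = {y \<in> topspace T. pr (l x) y = pr (l x) x}" for x
  have "(\<forall>U\<in>N ` topspace T. openin T U) \<and> topspace T \<subseteq> \<Union>(N ` topspace T)"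
    using op l(1) by (auto simp: N_def)
  from T[unfolded compact_space_alt, THEN spec, THEN mp, OF this]
  obtain \<F> where F: "finite \<F>" "\<F> \<subseteq> N ` topspace T" "topspace T \<subseteq> \<Union>\<F>"
    by auto
  obtain C where C: "C \<subseteq> topspace T" "finite C" "topspace T \<subseteq> \<Union>(N ` C)"
    using finite_subset_image[OF F(1,2)] F(3) by auto
  have "finite (l ` C)" "l ` C \<subseteq> I"
    using C(1,2) l(1) by auto
  from dir[OF this] obtain i where i: "i \<in> I"
    "\<And>x y z. \<lbrakk>z \<in> C; x \<in> topspace T; y \<in> topspace T; pr i x = pr i y\<rbrakk> \<Longrightarrow> pr (l z) x = pr (l z) y"
    by auto
  have "\<phi> x = \<phi> y" if xy: "x \<in> topspace T" "y \<in> topspace T" "pr i x = pr i y" for x y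
  proof -
    obtain z where z: "z \<in> C" "x \<in> N z" using C xy by auto
    have zX: "z \<in> topspace T" using z C by auto
    have "pr (l z) y = pr (l z) z"
      using z i(2)[OF z(1) xy] by (simp add: N_def)
    then show ?thesis
      using l(2)[OF zX xy(2)] l(2)[OF zX xy(1)] z by (simp add: N_def)
  qed
  then show ?thesis using i(1) by blast
qed

lemma topspace_quot_limit_topology [simp]:
  "topspace (quot_limit_topology R I A) = carrier (quot_limit R I A)"
  by (auto simp: quot_limit_topology_def quot_limit_def)

lemma openin_quot_limit_fibre:
  assumes "i \<in> I"
  shows "openin (quot_limit_topology R I A) {x \<in> carrier (quot_limit R I A). x i = c}"
proof -
  let ?P = "product_topology (\<lambda>i. discrete_topology (carrier (R Quot A i))) I"
  \<comment> \<open>Intersecting with the carrier gives an open set of the discrete topology even if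
    \<open>c\<close> is not a coset.\<close>
  have "openin ?P {x \<in> topspace ?P. x i \<in> {c} \<inter> carrier (R Quot A i)}"
    by (rule openin_continuous_map_preimage[OF continuous_map_product_projection[OF assms]]) simp
  moreover have "{x \<in> carrier (quot_limit R I A). x i = c} =
      carrier (quot_limit R I A) \<inter> {x \<in> topspace ?P. x i \<in> {c} \<inter> carrier (R Quot A i)}"
    using assms by (auto simp: quot_limit_def)
  ultimately show ?thesis
    unfolding quot_limit_topology_def by (simp add: openin_subtopology_Int2)
qed

text \<open>A basic open set constrains finitely many coordinates, and on the limit these are all
  functions of one deeper coordinate.\<close>

lemma quot_limit_topology_nhd:
  assumes dir: "\<And>K. \<lbrakk>finite K; K \<subseteq> I\<rbrakk> \<Longrightarrow> \<exists>i\<in>I. \<forall>j\<in>K. A i \<subseteq> A j"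
    and U: "openin (quot_limit_topology R I A) U" and u: "u \<in> U"
  shows "\<exists>i\<in>I. \<forall>v\<in>carrier (quot_limit R I A). v i = u i \<longrightarrow> v \<in> U"
proof -
  let ?P = "product_topology (\<lambda>i. discrete_topology (carrier (R Quot A i))) I"
  let ?L = "carrier (quot_limit R I A)"
  obtain W where W: "openin ?P W" "U = W \<inter> ?L"
    using U unfolding quot_limit_topology_def openin_subtopology by auto
  obtain V where V: "finite {i \<in> I. V i \<noteq> carrier (R Quot A i)}" "u \<in> Pi\<^sub>E I V" "Pi\<^sub>E I V \<subseteq> W"
    using W u unfolding openin_product_topology_alt by auto
  obtain i where i: "i \<in> I" "\<And>j. \<lbrakk>j \<in> I; V j \<noteq> carrier (R Quot A j)\<rbrakk> \<Longrightarrow> A i \<subseteq> A j"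
    using dir[OF V(1)] by auto
  have uL: "u \<in> ?L" using u W by auto
  have "v \<in> U" if v: "v \<in> ?L" and eq: "v i = u i" for v
  proof -
    have "v j \<in> V j" if j: "j \<in> I" for j
    proof (cases "V j = carrier (R Quot A j)")
      case True
      then show ?thesis using quot_limit_in_Quot[OF v j] by simp
    next
      case False
      have "v j = u j"
        using quot_limit_compat[OF v i(1) j i(2)[OF j False]] quot_limit_compat[OF uL i(1) j i(2)[OF j False]] eq
        by simp
      then show ?thesis using V(2) j by auto
    qed
    then have "v \<in> Pi\<^sub>E I V"
      using quot_limit_extensional[OF v] by (auto simp: PiE_iff)
    then show ?thesis using V W v by auto
  qed
  then show ?thesis using i by blast
qed

text \<open>By Tychonoff it is enough that the limit is closed in the product. A violated
  compatibility is visible in two coordinates, hence persists on a neighbourhood.\<close>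

lemma quot_limit_compact_space:
  assumes fin: "\<And>i. i \<in> I \<Longrightarrow> finite (carrier (R Quot A i))"
  shows "compact_space (quot_limit_topology R I A)"
proof -
  let ?P = "product_topology (\<lambda>i. discrete_topology (carrier (R Quot A i))) I"
  let ?L = "carrier (quot_limit R I A)"
  have P: "compact_space ?P"
    using fin by (auto simp: compact_space_product_topology compact_space_discrete_topology)
  have fib: "openin ?P {x \<in> topspace ?P. x i = c}" if "i \<in> I" for i c
  proof -
    have "openin ?P {x \<in> topspace ?P. x i \<in> {c} \<inter> carrier (R Quot A i)}"
      by (rule openin_continuous_map_preimage[OF continuous_map_product_projection[OF that]]) simp
    moreover have "{x \<in> topspace ?P. x i \<in> {c} \<inter> carrier (R Quot A i)} = {x \<in> topspace ?P. x i = c}"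
      using that by auto
    ultimately show ?thesis by simp
  qed
  have "openin ?P (topspace ?P - ?L)"
    unfolding openin_subopen[of ?P "topspace ?P - ?L"]
  proof
    fix x assume x: "x \<in> topspace ?P - ?L"
    then obtain i j where ij: "i \<in> I" "j \<in> I" "A i \<subseteq> A j" "x j \<noteq> A j <+>\<^bsub>R\<^esub> x i"
      by (auto simp: quot_limit_def)
    have "openin ?P ({y \<in> topspace ?P. y i = x i} \<inter> {y \<in> topspace ?P. y j = x j})"
      by (intro openin_Int fib ij)
    moreover have "{y \<in> topspace ?P. y i = x i} \<inter> {y \<in> topspace ?P. y j = x j} \<subseteq> topspace ?P - ?L"
    proof
      fix y assume y: "y \<in> {y \<in> topspace ?P. y i = x i} \<inter> {y \<in> topspace ?P. y j = x j}"
      have "y \<notin> ?L"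
        using quot_limit_compat[of y R I A i j] ij y by auto
      then show "y \<in> topspace ?P - ?L" using y by blast
    qed
    ultimately show "\<exists>T. openin ?P T \<and> x \<in> T \<and> T \<subseteq> topspace ?P - ?L"
      using x by blast
  qed
  then have "closedin ?P ?L"
    unfolding closedin_def by (auto simp: quot_limit_def)
  then have "compactin ?P ?L"
    by (rule closedin_compact_space[OF P])
  then show ?thesis
    unfolding quot_limit_topology_def by (rule compact_space_subtopology)
qed

lemma quot_limit_power_nhd:
  fixes k :: nat
  assumes dir: "\<And>K. \<lbrakk>finite K; K \<subseteq> I\<rbrakk> \<Longrightarrow> \<exists>i\<in>I. \<forall>j\<in>K. A i \<subseteq> A j"
    and U: "openin (product_topology (\<lambda>_. quot_limit_topology R I A) {..<k}) U" and u: "u \<in> U"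
  shows "\<exists>i\<in>I. \<forall>v\<in>{..<k} \<rightarrow>\<^sub>E carrier (quot_limit R I A). (\<forall>l<k. v l i = u l i) \<longrightarrow> v \<in> U"
proof -
  let ?L = "carrier (quot_limit R I A)"
  obtain V where V: "\<And>l. l < k \<Longrightarrow> openin (quot_limit_topology R I A) (V l)" "u \<in> Pi\<^sub>E {..<k} V" "Pi\<^sub>E {..<k} V \<subseteq> U"
    using bspec[OF U[unfolded openin_product_topology_alt] u] by auto
  have uL: "u l \<in> ?L" if "l < k" for l
    using openin_subset[OF V(1)[OF that]] V(2) that by auto
  have "\<exists>i\<in>I. \<forall>v\<in>?L. v i = u l i \<longrightarrow> v \<in> V l" if "l < k" for l
    using quot_limit_topology_nhd[OF dir V(1)[OF that], of "u l"] V(2) that by auto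
  then obtain n where n: "\<And>l. l < k \<Longrightarrow> n l \<in> I"
      "\<And>l v. \<lbrakk>l < k; v \<in> ?L; v (n l) = u l (n l)\<rbrakk> \<Longrightarrow> v \<in> V l"
    by metis
  have "finite (n ` {..<k})" "n ` {..<k} \<subseteq> I"
    using n(1) by auto
  from dir[OF this] obtain i where i: "i \<in> I" "\<And>l. l < k \<Longrightarrow> A i \<subseteq> A (n l)"
    by auto
  have "v \<in> U" if v: "v \<in> {..<k} \<rightarrow>\<^sub>E ?L" and eq: "\<forall>l<k. v l i = u l i" for v
  proof -
    have "v l \<in> V l" if l: "l < k" for l
    proof (rule n(2)[OF l])
      show vl: "v l \<in> ?L" using v l by auto
      show "v l (n l) = u l (n l)"
        using quot_limit_compat[OF vl i(1) n(1)[OF l] i(2)[OF l]]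
          quot_limit_compat[OF uL[OF l] i(1) n(1)[OF l] i(2)[OF l]] eq l by simp
    qed
    then have "v \<in> Pi\<^sub>E {..<k} V" using v by (auto simp: PiE_iff)
    then show ?thesis using V by auto
  qed
  then show ?thesis using i by blast
qed

text \<open>Apply \<open>compact_space_uniform_level\<close> to membership in \<open>C\<close>:
  openness makes it locally constant at points of \<open>C\<close>, closedness at the other
  points.\<close>

lemma quot_limit_power_clopen_level:
  fixes k :: nat and R :: "('a, 'm) ring_scheme" and A :: "'i \<Rightarrow> 'a set"
  assumes fin: "\<And>i. i \<in> I \<Longrightarrow> finite (carrier (R Quot A i))"
    and dir: "\<And>K. \<lbrakk>finite K; K \<subseteq> I\<rbrakk> \<Longrightarrow> \<exists>i\<in>I. \<forall>j\<in>K. A i \<subseteq> A j"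
    and C: "openin (product_topology (\<lambda>_. quot_limit_topology R I A) {..<k}) C"
      "closedin (product_topology (\<lambda>_. quot_limit_topology R I A) {..<k}) C"
  shows "\<exists>i\<in>I. \<forall>u\<in>{..<k} \<rightarrow>\<^sub>E carrier (quot_limit R I A). \<forall>v\<in>{..<k} \<rightarrow>\<^sub>E carrier (quot_limit R I A).
           (\<forall>l<k. u l i = v l i) \<longrightarrow> (u \<in> C \<longleftrightarrow> v \<in> C)"
proof -
  let ?L = "carrier (quot_limit R I A)"
  let ?T = "product_topology (\<lambda>_. quot_limit_topology R I A) {..<k}"
  define pr where "pr i u = (\<lambda>l\<in>{..<k}. u l i)" for i and u :: "nat \<Rightarrow> 'i \<Rightarrow> 'a set"
  have pr_eq: "pr i u = pr i v \<longleftrightarrow> (\<forall>l<k. u l i = v l i)" for i u v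
    by (auto simp: pr_def restrict_def fun_eq_iff)
  have top: "topspace ?T = {..<k} \<rightarrow>\<^sub>E ?L" by simp
  have "\<exists>i\<in>I. \<forall>u\<in>topspace ?T. \<forall>v\<in>topspace ?T. pr i u = pr i v \<longrightarrow> (u \<in> C) = (v \<in> C)"
  proof (rule compact_space_uniform_level)
    show "compact_space ?T"
      unfolding compact_space_product_topology by (intro disjI2 ballI quot_limit_compact_space fin)
  next
    fix K assume K: "finite K" "K \<subseteq> I"
    then obtain i where i: "i \<in> I" "\<forall>j\<in>K. A i \<subseteq> A j" using dir by blast
    have "u l j = v l j" if "j \<in> K" "u \<in> topspace ?T" "v \<in> topspace ?T" "pr i u = pr i v" "l < k" for u v j l
    proof -
      have "u l \<in> ?L" "v l \<in> ?L" using that by auto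
      then show ?thesis
        using quot_limit_compat[of "u l" R I A i j] quot_limit_compat[of "v l" R I A i j] i K that
        unfolding pr_eq by (metis subsetD)
    qed
    then show "\<exists>i\<in>I. \<forall>j\<in>K. \<forall>x\<in>topspace ?T. \<forall>y\<in>topspace ?T. pr i x = pr i y \<longrightarrow> pr j x = pr j y"
      using i(1) unfolding pr_eq by blast
  next
    fix i c assume i: "i \<in> I"
    show "openin ?T {x \<in> topspace ?T. pr i x = c}"
    proof (cases "c \<in> extensional {..<k}")
      case False
      then have "{x \<in> topspace ?T. pr i x = c} = {}" by (auto simp: pr_def)
      then show ?thesis by (metis openin_empty)
    next
      case True
      have eq: "{x \<in> topspace ?T. pr i x = c} = (\<Pi>\<^sub>E l\<in>{..<k}. {x \<in> ?L. x i = c l})"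
        unfolding top using True by (auto simp: pr_def PiE_iff extensional_def fun_eq_iff)
      then show ?thesis
        unfolding eq openin_PiE_gen
        by (intro disjI2 conjI ballI openin_quot_limit_fibre[OF i]) simp
    qed
  next
    fix x assume x: "x \<in> topspace ?T"
    show "\<exists>i\<in>I. \<forall>y\<in>topspace ?T. pr i y = pr i x \<longrightarrow> (y \<in> C) = (x \<in> C)"
    proof (cases "x \<in> C")
      case True
      then show ?thesis
        using quot_limit_power_nhd[OF dir C(1) True] unfolding top pr_eq by auto
    next
      case False
      have "openin ?T (topspace ?T - C)" "x \<in> topspace ?T - C"
        using C(2) x False by (auto simp: closedin_def)
      then show ?thesis
        using quot_limit_power_nhd[OF dir, of R k "topspace ?T - C" x] False unfolding pr_eq top by auto
    qed
  qed
  then show ?thesis unfolding top pr_eq .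
qed

section \<open>Test functions on \<open>Dhat\<close>, local closures and Eulerian sets\<close>

lemma topspace_Dhat [simp]: "topspace (Dhat_topology D) = carrier (Dhat D)"
  by (simp add: Dhat_topology_def Dhat_def)

lemma openin_Dhat_fibre:
  "I \<in> nonzero_ideals D \<Longrightarrow> openin (Dhat_topology D) {x \<in> carrier (Dhat D). x I = c}"
  unfolding Dhat_topology_def Dhat_def by (rule openin_quot_limit_fibre)

lemma Hausdorff_Dhat: "Hausdorff_space (Dhat_topology D)"
  unfolding Dhat_topology_def quot_limit_topology_def
  by (intro Hausdorff_space_subtopology) (simp add: Hausdorff_space_product_topology)

context finite_quotient_domain
begin

text \<open>Compactness of \<open>Dhat\<close> turns local constancy into dependence on one residue.
  The ideal found here becomes the \<open>B\<close> of the fibre count.\<close>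

lemma Dhat_test_function_level:
  assumes \<phi>: "\<phi> \<in> test_functions (Dhat_topology R)"
  shows "\<exists>I\<in>nonzero_ideals R. \<forall>x\<in>carrier (Dhat R). \<forall>y\<in>carrier (Dhat R). x I = y I \<longrightarrow> \<phi> x = \<phi> y"
proof -
  let ?T = "Dhat_topology R"
  have "\<exists>I\<in>nonzero_ideals R. \<forall>x\<in>topspace ?T. \<forall>y\<in>topspace ?T. x I = y I \<longrightarrow> \<phi> x = \<phi> y"
  proof (rule compact_space_uniform_level)
    show "compact_space ?T"
      unfolding Dhat_topology_def by (intro quot_limit_compact_space finite_Quot)
  next
    fix K assume K: "finite K" "K \<subseteq> nonzero_ideals R"
    from nonzero_ideals_directed[OF this] obtain I where I: "I \<in> nonzero_ideals R" "\<forall>J\<in>K. I \<subseteq> J"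
      by auto
    show "\<exists>I\<in>nonzero_ideals R. \<forall>J\<in>K. \<forall>x\<in>topspace ?T. \<forall>y\<in>topspace ?T. x I = y I \<longrightarrow> x J = y J"
    proof (intro bexI[OF _ I(1)] ballI impI)
      fix J x y
      assume "J \<in> K" "x \<in> topspace ?T" "y \<in> topspace ?T" "x I = y I"
      then show "x J = y J"
        using Dhat_eq_superset[of x y I J] I K(2) by auto
    qed
  next
    fix I c assume "I \<in> nonzero_ideals R"
    then show "openin ?T {x \<in> topspace ?T. x I = c}"
      using openin_Dhat_fibre by simp
  next
    fix x assume x: "x \<in> topspace ?T"
    then obtain U where U: "openin ?T U" "x \<in> U" "\<forall>y\<in>U. \<phi> y = \<phi> x"
      using \<phi> unfolding test_functions_def by blast
    have "\<exists>I\<in>nonzero_ideals R. \<forall>v\<in>carrier (Dhat R). v I = x I \<longrightarrow> v \<in> U"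
      unfolding Dhat_def
      by (rule quot_limit_topology_nhd[OF _ U(1)[unfolded Dhat_topology_def] U(2)])
        (rule nonzero_ideals_directed)
    then show "\<exists>I\<in>nonzero_ideals R. \<forall>y\<in>topspace ?T. y I = x I \<longrightarrow> \<phi> y = \<phi> x"
      unfolding topspace_Dhat using U(3) by blast
  qed
  then show ?thesis by simp
qed

lemma proj_at_in_topspace:
  assumes P: "P \<in> nonzero_primes R" and x: "\<And>i. i < k \<Longrightarrow> x i \<in> carrier (Dhat R)"
  shows "proj_at R k P x \<in> {..<k} \<rightarrow>\<^sub>E carrier (quot_limit R UNIV (ideal_power R P))"
proof -
  have "(\<lambda>j. x i (ideal_power R P j)) \<in> carrier (quot_limit R UNIV (ideal_power R P))" if "i < k" for i
    unfolding quot_limit_carrier_iff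
    using Dhat_in_Quot[OF x[OF that]] Dhat_compat[OF x[OF that]] prime_power_nonzero[OF P] by simp
  then show ?thesis
    by (simp add: proj_at_def)
qed

text \<open>The local closure is closed by construction and open by hypothesis. This is where open
  Eulerianness, rather than Eulerianness, enters.\<close>

lemma local_closure_level:
  assumes P: "P \<in> nonzero_primes R"
    and op: "openin (Dhat_at_power_topology R k P) (local_closure R k Y P)"
  shows "\<exists>n. \<forall>u\<in>{..<k} \<rightarrow>\<^sub>E carrier (quot_limit R UNIV (ideal_power R P)).
      \<forall>v\<in>{..<k} \<rightarrow>\<^sub>E carrier (quot_limit R UNIV (ideal_power R P)).
        (\<forall>l<k. u l n = v l n) \<longrightarrow> (u \<in> local_closure R k Y P \<longleftrightarrow> v \<in> local_closure R k Y P)"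
proof -
  have "\<exists>n\<in>UNIV. \<forall>u\<in>{..<k} \<rightarrow>\<^sub>E carrier (quot_limit R UNIV (ideal_power R P)).
      \<forall>v\<in>{..<k} \<rightarrow>\<^sub>E carrier (quot_limit R UNIV (ideal_power R P)).
        (\<forall>l<k. u l n = v l n) \<longrightarrow> (u \<in> local_closure R k Y P \<longleftrightarrow> v \<in> local_closure R k Y P)"
  proof (rule quot_limit_power_clopen_level)
    show "finite (carrier (R Quot ideal_power R P i))" for i
      using P by (intro finite_Quot prime_power_nonzero)
    show "\<exists>i\<in>UNIV. \<forall>j\<in>K. ideal_power R P i \<subseteq> ideal_power R P j" if "finite K" for K :: "nat set"
      using prime_power_antimono[OF P Max_ge[OF that]] by (intro bexI[of _ "Max K"]) auto
    show "openin (product_topology (\<lambda>_. quot_limit_topology R UNIV (ideal_power R P)) {..<k}) (local_closure R k Y P)"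
      using op by (simp add: Dhat_at_power_topology_def Dhat_at_topology_def)
    show "closedin (product_topology (\<lambda>_. quot_limit_topology R UNIV (ideal_power R P)) {..<k}) (local_closure R k Y P)"
      by (simp add: local_closure_def Dhat_at_power_topology_def Dhat_at_topology_def)
  qed
  then show ?thesis by simp
qed

text \<open>\<open>eulerian\<close> equates images under the map to the product over the primes.
  Membership of \<open>x\<close> itself is recovered because that map is injective on
  tuples.\<close>

lemma eulerian_mem_iff:
  assumes eu: "eulerian R k Y" and x: "x \<in> {..<k} \<rightarrow>\<^sub>E carrier (Dhat R)"
  shows "x \<in> Dhat_closure R k Y \<longleftrightarrow> (\<forall>P\<in>nonzero_primes R. proj_at R k P x \<in> local_closure R k Y P)"
proof
  assume "x \<in> Dhat_closure R k Y"
  then have "(\<lambda>P\<in>nonzero_primes R. proj_at R k P x) \<in> (\<Pi>\<^sub>E P\<in>nonzero_primes R. local_closure R k Y P)"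
    using eu unfolding eulerian_def by blast
  then show "\<forall>P\<in>nonzero_primes R. proj_at R k P x \<in> local_closure R k Y P"
    by (auto simp: PiE_iff)
next
  assume "\<forall>P\<in>nonzero_primes R. proj_at R k P x \<in> local_closure R k Y P"
  then have "(\<lambda>P\<in>nonzero_primes R. proj_at R k P x) \<in> (\<Pi>\<^sub>E P\<in>nonzero_primes R. local_closure R k Y P)"
    by auto
  then obtain y where y: "y \<in> Dhat_closure R k Y"
    and eq: "(\<lambda>P\<in>nonzero_primes R. proj_at R k P x) = (\<lambda>P\<in>nonzero_primes R. proj_at R k P y)"
    using eu unfolding eulerian_def by (metis (no_types, lifting) imageE)
  have "y \<in> topspace (Dhat_power_topology R k)"
    by (rule subsetD[OF closure_of_subset_topspace y[unfolded Dhat_closure_def]])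
  then have yT: "y \<in> {..<k} \<rightarrow>\<^sub>E carrier (Dhat R)"
    by (simp add: Dhat_power_topology_def)
  have "x i = y i" if i: "i < k" for i
  proof (rule Dhat_ext_primes)
    show "x i \<in> carrier (Dhat R)" "y i \<in> carrier (Dhat R)" using x yT i by auto
    fix P n assume "P \<in> nonzero_primes R"
    then have "proj_at R k P x = proj_at R k P y" using eq by (metis restrict_apply')
    then have "proj_at R k P x i n = proj_at R k P y i n" by simp
    then show "x i (ideal_power R P n) = y i (ideal_power R P n)"
      using i by (simp add: proj_at_def)
  qed
  then have "x = y" using PiE_ext[OF x yT] by simp
  then show "x \<in> Dhat_closure R k Y" using y by simp
qed

text \<open>Polynomials preserve congruences, so the level at which the local closure at
  \<open>P\<close> is decided serves unchanged for its preimage.\<close>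

lemma poly_preimage_fibre_card:
  assumes f: "\<And>i. i < k \<Longrightarrow> f i \<in> carrier (UP R)"
    and oe: "openly_eulerian R k Y"
    and Z: "Z = {a \<in> carrier (Dhat R). poly_map R k f a \<in> Dhat_closure R k Y}"
    and B: "B \<in> nonzero_ideals R"
  shows "\<exists>E\<in>nonzero_ideals R. E \<subseteq> B \<and> (\<forall>A\<in>nonzero_ideals R. A \<subseteq> E \<longrightarrow>
     (\<forall>c\<in>(\<lambda>x. x E) ` Z. \<forall>d\<in>(\<lambda>x. x E) ` Z.
       card {u \<in> (\<lambda>x. x A) ` Z. E <+> u = c} = card {u \<in> (\<lambda>x. x A) ` Z. E <+> u = d}))"
proof (rule prime_local_fibre_card[OF _ _ B])
  let ?Q = "\<lambda>P a. proj_at R k P (poly_map R k f a) \<in> local_closure R k Y P"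
  have eu: "eulerian R k Y"
    and op: "\<And>P. P \<in> nonzero_primes R \<Longrightarrow> openin (Dhat_at_power_topology R k P) (local_closure R k Y P)"
    using oe by (auto simp: openly_eulerian_def)
  have pm: "poly_map R k f a i \<in> carrier (Dhat R)" if "a \<in> carrier (Dhat R)" "i < k" for a i
    using that f Dhat_poly_eval_closed by (simp add: poly_map_def)
  show "Z = {a \<in> carrier (Dhat R). \<forall>P\<in>nonzero_primes R. ?Q P a}"
    unfolding Z
  proof (intro Collect_cong conj_cong refl)
    fix a assume "a \<in> carrier (Dhat R)"
    then have "poly_map R k f a \<in> {..<k} \<rightarrow>\<^sub>E carrier (Dhat R)"
      using pm by (auto simp: PiE_iff poly_map_def)
    then show "poly_map R k f a \<in> Dhat_closure R k Y \<longleftrightarrow> (\<forall>P\<in>nonzero_primes R. ?Q P a)"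
      by (rule eulerian_mem_iff[OF eu])
  qed
  fix P assume P: "P \<in> nonzero_primes R"
  obtain n where n: "\<And>u v. \<lbrakk>u \<in> {..<k} \<rightarrow>\<^sub>E carrier (quot_limit R UNIV (ideal_power R P));
      v \<in> {..<k} \<rightarrow>\<^sub>E carrier (quot_limit R UNIV (ideal_power R P)); \<forall>l<k. u l n = v l n;
      u \<in> local_closure R k Y P\<rbrakk> \<Longrightarrow> v \<in> local_closure R k Y P"
    using local_closure_level[OF P op[OF P]] by metis
  show "\<exists>n. \<forall>x\<in>carrier (Dhat R). \<forall>y\<in>carrier (Dhat R).
      x (ideal_power R P n) = y (ideal_power R P n) \<longrightarrow> ?Q P x \<longrightarrow> ?Q P y"
  proof (intro exI ballI impI)
    fix x y assume x: "x \<in> carrier (Dhat R)" and y: "y \<in> carrier (Dhat R)"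
      and eq: "x (ideal_power R P n) = y (ideal_power R P n)" and Q: "?Q P x"
    show "?Q P y"
    proof (rule n[OF proj_at_in_topspace[OF P pm[OF x]] proj_at_in_topspace[OF P pm[OF y]] _ Q])
      show "\<forall>l<k. proj_at R k P (poly_map R k f x) l n = proj_at R k P (poly_map R k f y) l n"
        using Dhat_poly_eval_cong[OF f x y prime_power_nonzero[OF P] eq]
        by (simp add: proj_at_def poly_map_def)
    qed
  qed
qed

end

section \<open>S-integers\<close>

lemma S_integers_domain:
  assumes F: "field F" and arch: "archimedean_places F \<subseteq> S"
  shows "domain (S_integers F S)"
proof -
  interpret field F by fact
  define H where "H = {x \<in> carrier F. \<forall>P\<in>places F - S. \<forall>v\<in>P. v x \<le> 1}"
  have nontrivial: "nontrivial_absolute_value F v" if "P \<in> places F" "v \<in> P" for P v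
    using that by (auto simp: places_def quotient_def absolute_value_equiv_def)
  have powr_le_1_iff: "a powr s \<le> 1 \<longleftrightarrow> a \<le> 1" if "0 \<le> a" "0 < s" for a s :: real
    using that powr_le1[of s a] gr_one_powr[of a s] by (auto simp: not_le[symmetric])
  \<comment> \<open>A place outside \<open>S\<close> is not archimedean, which provides one
    ultrametric representative \<open>w\<close> of its class. Being at most 1 is invariant under
    positive powers, so the bound passes from \<open>w\<close> through \<open>v0\<close> to every
    \<open>v\<close> in the class.\<close>
  have ultra: "v (x \<oplus>\<^bsub>F\<^esub> y) \<le> 1"
    if P: "P \<in> places F - S" and v: "v \<in> P" and x: "x \<in> H" and y: "y \<in> H" for P v x y
  proof -
    have "P \<in> places F" "P \<notin> archimedean_places F" using P arch by auto
    then obtain w where w: "w \<in> P"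
        "\<forall>x\<in>carrier F. \<forall>y\<in>carrier F. w (x \<oplus>\<^bsub>F\<^esub> y) \<le> max (w x) (w y)"
      by (auto simp: archimedean_places_def)
    obtain v0 where v0: "P = absolute_value_equiv F `` {v0}"
      using P by (auto simp: places_def quotient_def)
    have nv0: "nontrivial_absolute_value F v0" using v0 v by (auto simp: absolute_value_equiv_def)
    obtain s where s: "s > 0" "\<forall>x\<in>carrier F. w x = v0 x powr s"
      using v0 w by (auto simp: absolute_value_equiv_def)
    obtain t where t: "t > 0" "\<forall>x\<in>carrier F. v x = v0 x powr t"
      using v0 v by (auto simp: absolute_value_equiv_def)
    have xy: "x \<in> carrier F" "y \<in> carrier F" "x \<oplus>\<^bsub>F\<^esub> y \<in> carrier F"
      using x y by (auto simp: H_def)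
    have nn: "0 \<le> v0 (x \<oplus>\<^bsub>F\<^esub> y)" using nv0 xy by (simp add: nontrivial_absolute_value_def)
    have "w x \<le> 1" "w y \<le> 1" using x y P w by (auto simp: H_def)
    then have "w (x \<oplus>\<^bsub>F\<^esub> y) \<le> 1" using w(2) xy by (meson max.boundedI order_trans)
    then have "v0 (x \<oplus>\<^bsub>F\<^esub> y) \<le> 1" using s xy nn by (simp add: powr_le_1_iff)
    then show ?thesis using t xy nn by (simp add: powr_le_1_iff)
  qed
  have val_one: "v \<one>\<^bsub>F\<^esub> = 1" if v: "nontrivial_absolute_value F v" for v
  proof -
    have "v \<one>\<^bsub>F\<^esub> * v \<one>\<^bsub>F\<^esub> = v (\<one>\<^bsub>F\<^esub> \<otimes>\<^bsub>F\<^esub> \<one>\<^bsub>F\<^esub>)"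
      using v one_closed unfolding nontrivial_absolute_value_def by metis
    moreover have "v \<one>\<^bsub>F\<^esub> \<noteq> 0"
      using v one_closed one_not_zero unfolding nontrivial_absolute_value_def by metis
    ultimately show ?thesis by simp
  qed
  have val_mult: "v (x \<otimes>\<^bsub>F\<^esub> y) = v x * v y" "0 \<le> v x"
    if "nontrivial_absolute_value F v" "x \<in> carrier F" "y \<in> carrier F" for v x y
    using that by (simp_all add: nontrivial_absolute_value_def)
  have val_minus: "v (\<ominus>\<^bsub>F\<^esub> x) = v x" if v: "nontrivial_absolute_value F v" and x: "x \<in> carrier F" for v x
  proof -
    let ?m = "\<ominus>\<^bsub>F\<^esub> \<one>\<^bsub>F\<^esub>"
    have "v ?m * v ?m = v (?m \<otimes>\<^bsub>F\<^esub> ?m)" using val_mult[OF v] by simp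
    also have "?m \<otimes>\<^bsub>F\<^esub> ?m = \<one>\<^bsub>F\<^esub>" by algebra
    finally have "(v ?m)\<^sup>2 = 1" using val_one[OF v] by (simp add: power2_eq_square)
    moreover have "0 \<le> v ?m" using val_mult(2)[OF v, of ?m \<open>\<one>\<^bsub>F\<^esub>\<close>] by simp
    ultimately have "v ?m = 1" by (simp add: power2_eq_1_iff)
    moreover have "\<ominus>\<^bsub>F\<^esub> x = ?m \<otimes>\<^bsub>F\<^esub> x" using x by algebra
    ultimately show ?thesis using val_mult(1)[OF v, of ?m x] x by simp
  qed
  have "subring H F"
  proof (rule subringI)
    show "H \<subseteq> carrier F" by (auto simp: H_def)
    show "\<one>\<^bsub>F\<^esub> \<in> H" by (auto simp: H_def intro!: eq_refl val_one nontrivial)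
    show "\<ominus>\<^bsub>F\<^esub> h \<in> H" if h: "h \<in> H" for h
    proof -
      have "v (\<ominus>\<^bsub>F\<^esub> h) \<le> 1" if "P \<in> places F - S" "v \<in> P" for P v
        using val_minus[OF nontrivial[of P v], of h] that h by (auto simp: H_def)
      then show ?thesis using h by (auto simp: H_def)
    qed
    show "h1 \<otimes>\<^bsub>F\<^esub> h2 \<in> H" if h: "h1 \<in> H" "h2 \<in> H" for h1 h2
    proof -
      have "v (h1 \<otimes>\<^bsub>F\<^esub> h2) \<le> 1" if P: "P \<in> places F - S" "v \<in> P" for P v
      proof -
        have v: "nontrivial_absolute_value F v" using P by (intro nontrivial[of P v]) auto
        have "v h1 * v h2 \<le> 1"
          using h P val_mult(2)[OF v, of h2 h2] by (intro mult_le_one) (auto simp: H_def)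
        then show ?thesis using val_mult(1)[OF v] h by (simp add: H_def)
      qed
      then show ?thesis using h by (auto simp: H_def)
    qed
    show "h1 \<oplus>\<^bsub>F\<^esub> h2 \<in> H" if "h1 \<in> H" "h2 \<in> H" for h1 h2
      using that ultra by (auto simp: H_def)
  qed
  then show ?thesis
    unfolding S_integers_def H_def[symmetric] by (rule subring_is_domain)
qed

section \<open>Haar measure and the limit\<close>

locale Dhat_haar = domain +
  fixes M :: "('a set \<Rightarrow> 'a set) measure"
  assumes haar: "normalized_haar_measure (Dhat R) (Dhat_topology R) M"
begin

lemma space_haar: "space M = carrier (Dhat R)"
proof -
  have "sets M = sets (sigma (topspace (Dhat_topology R)) {U. openin (Dhat_topology R) U})"
    using haar by (simp add: normalized_haar_measure_def)
  then have "space M = space (sigma (topspace (Dhat_topology R)) {U. openin (Dhat_topology R) U})"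
    by (rule sets_eq_imp_space_eq)
  also have "\<dots> = topspace (Dhat_topology R)"
    by (rule space_measure_of) (blast dest: openin_subset)
  finally show ?thesis by simp
qed

lemma open_in_sets_haar:
  assumes "openin (Dhat_topology R) U"
  shows "U \<in> sets M"
proof -
  have "sets M = sets (sigma (topspace (Dhat_topology R)) {U. openin (Dhat_topology R) U})"
    using haar by (simp add: normalized_haar_measure_def)
  also have "\<dots> = sigma_sets (topspace (Dhat_topology R)) {U. openin (Dhat_topology R) U}"
    by (rule sets_measure_of) (blast dest: openin_subset)
  finally show ?thesis using assms by (auto intro: sigma_sets.Basic)
qed

lemma emeasure_space_haar: "emeasure M (space M) = 1"
  using haar by (simp add: normalized_haar_measure_def)

lemma finite_measure_haar: "finite_measure M"
  by (rule finite_measureI) (simp add: emeasure_space_haar)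

lemma measure_space_haar: "measure M (space M) = 1"
  by (simp add: measure_def emeasure_space_haar)

section \<open>Masses of residue classes\<close>

definition fibre :: "'a set \<Rightarrow> 'a set \<Rightarrow> ('a set \<Rightarrow> 'a set) set" where
  "fibre I c = {x \<in> carrier (Dhat R). x I = c}"

lemma openin_fibre: "I \<in> nonzero_ideals R \<Longrightarrow> openin (Dhat_topology R) (fibre I c)"
  unfolding fibre_def by (rule openin_Dhat_fibre)

lemma fibre_in_sets: "I \<in> nonzero_ideals R \<Longrightarrow> fibre I c \<in> sets M"
  by (intro open_in_sets_haar openin_fibre)

text \<open>\<open>fibre I I\<close> is the kernel of the projection, as the zero of
  \<open>R Quot I\<close> is the set \<open>I\<close> itself.\<close>

lemma fibre_translate:
  assumes I: "I \<in> nonzero_ideals R" and r: "r \<in> carrier R"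
  shows "fibre I (I +> r) = (\<lambda>y. Dhat_embed R r \<oplus>\<^bsub>Dhat R\<^esub> y) ` fibre I I"
proof -
  interpret L: cring "Dhat R" by (rule Dhat_cring)
  interpret h: ring_hom_cring "Dhat R" "R Quot I" "\<lambda>x. x I"
    using Dhat_eval_ring_hom_cring[OF I] .
  have e: "Dhat_embed R r \<in> carrier (Dhat R)" "Dhat_embed R r I = I +> r"
    using r I by (simp_all add: Dhat_embed_closed Dhat_embed_apply)
  have zero: "\<zero>\<^bsub>R Quot I\<^esub> = I" by (simp add: FactRing_def)
  show ?thesis
  proof (intro equalityI subsetI)
    fix x assume "x \<in> fibre I (I +> r)"
    then have x: "x \<in> carrier (Dhat R)" "x I = I +> r" by (auto simp: fibre_def)
    let ?y = "\<ominus>\<^bsub>Dhat R\<^esub> Dhat_embed R r \<oplus>\<^bsub>Dhat R\<^esub> x"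
    have rQ: "I +> r \<in> carrier (R Quot I)" using r by (rule a_rcos_in_Quot)
    have "?y I = I"
      using x e zero rQ by (simp add: h.S.l_neg)
    then have "?y \<in> fibre I I" using x e by (simp add: fibre_def)
    moreover have "x = Dhat_embed R r \<oplus>\<^bsub>Dhat R\<^esub> ?y"
      using x e by (simp add: L.r_neg2)
    ultimately show "x \<in> (\<lambda>y. Dhat_embed R r \<oplus>\<^bsub>Dhat R\<^esub> y) ` fibre I I" by blast
  next
    fix x assume "x \<in> (\<lambda>y. Dhat_embed R r \<oplus>\<^bsub>Dhat R\<^esub> y) ` fibre I I"
    then obtain y where y: "y \<in> carrier (Dhat R)" "y I = I" "x = Dhat_embed R r \<oplus>\<^bsub>Dhat R\<^esub> y"
      by (auto simp: fibre_def)
    have rQ: "I +> r \<in> carrier (R Quot I)" using r by (rule a_rcos_in_Quot)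
    have "x I = (I +> r) \<oplus>\<^bsub>R Quot I\<^esub> \<zero>\<^bsub>R Quot I\<^esub>"
      using y e zero by simp
    then show "x \<in> fibre I (I +> r)"
      using y e rQ by (simp add: fibre_def)
  qed
qed

lemma measure_fibre_const:
  assumes I: "I \<in> nonzero_ideals R" and c: "c \<in> carrier (R Quot I)"
  shows "measure M (fibre I c) = measure M (fibre I I)"
proof -
  obtain r where r: "r \<in> carrier R" "c = I +> r" using c by (rule Quot_cases)
  have "emeasure M ((\<lambda>y. Dhat_embed R r \<oplus>\<^bsub>Dhat R\<^esub> y) ` fibre I I) = emeasure M (fibre I I)"
    using haar Dhat_embed_closed[OF r(1)] fibre_in_sets[OF I] unfolding normalized_haar_measure_def by blast
  then show ?thesis
    using fibre_translate[OF I r(1)] r(2) by (simp add: measure_def)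
qed

lemma measure_Union_fibre:
  assumes I: "I \<in> nonzero_ideals R" and C: "finite C" "C \<subseteq> carrier (R Quot I)"
  shows "measure M (\<Union>c\<in>C. fibre I c) = real (card C) * measure M (fibre I I)"
proof -
  interpret finite_measure M by (rule finite_measure_haar)
  have "measure M (\<Union>c\<in>C. fibre I c) = (\<Sum>c\<in>C. measure M (fibre I c))"
    using C fibre_in_sets[OF I]
    by (intro finite_measure_finite_Union) (auto simp: disjoint_family_on_def fibre_def)
  also have "\<dots> = (\<Sum>c\<in>C. measure M (fibre I I))"
    using C measure_fibre_const[OF I] by (intro sum.cong) auto
  finally show ?thesis by simp
qed

text \<open>If the fibres were null sets, so would be every compact set, since finitely many fibres cover
  it; this contradicts inner regularity.\<close>

lemma measure_fibre_nonzero: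
  assumes I: "I \<in> nonzero_ideals R"
  shows "measure M (fibre I I) \<noteq> 0"
proof
  assume 0: "measure M (fibre I I) = 0"
  interpret finite_measure M by (rule finite_measure_haar)
  let ?T = "Dhat_topology R" and ?Q = "carrier (R Quot I)"
  have "emeasure M K = 0" if K: "compactin ?T K" for K
  proof -
    have "K \<subseteq> \<Union>(fibre I ` ?Q)"
      using compactin_subset_topspace[OF K] Dhat_in_Quot I
      by (auto simp: fibre_def)
    then have "(\<forall>U\<in>fibre I ` ?Q. openin ?T U) \<and> K \<subseteq> \<Union>(fibre I ` ?Q)"
      using openin_fibre[OF I] by blast
    from K[unfolded compactin_def, THEN conjunct2, THEN spec, THEN mp, OF this]
    obtain \<F> where F: "finite \<F>" "\<F> \<subseteq> fibre I ` ?Q" "K \<subseteq> \<Union>\<F>" by auto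
    obtain C where C: "C \<subseteq> ?Q" "finite C" "\<F> = fibre I ` C"
      using finite_subset_image[OF F(1,2)] by auto
    have "emeasure M K \<le> emeasure M (\<Union>c\<in>C. fibre I c)"
      using F C fibre_in_sets[OF I] by (intro emeasure_mono) auto
    also have "\<dots> = 0"
      using measure_Union_fibre[OF I C(2,1)] 0 by (simp add: emeasure_eq_measure)
    finally show ?thesis by simp
  qed
  then have "(SUP K\<in>{K. compactin ?T K \<and> K \<subseteq> topspace ?T}. emeasure M K) \<le> 0"
    by (intro SUP_least) auto
  moreover have "emeasure M (topspace ?T) = (SUP K\<in>{K. compactin ?T K \<and> K \<subseteq> topspace ?T}. emeasure M K)"
    using haar openin_topspace unfolding normalized_haar_measure_def by blast
  ultimately show False
    using emeasure_space_haar by (simp add: space_haar)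
qed

text \<open>Disjoint classes of equal positive mass fit only finitely often into total mass 1.
  Compactness of \<open>Dhat\<close> cannot be invoked here, since its proof rests on this
  finiteness; hence the passage through compact subsets in
  \<open>measure_fibre_nonzero\<close>.\<close>

lemma finite_Quot_haar:
  assumes I: "I \<in> nonzero_ideals R"
  shows "finite (carrier (R Quot I))"
proof (rule ccontr)
  assume inf: "infinite (carrier (R Quot I))"
  interpret finite_measure M by (rule finite_measure_haar)
  have "of_nat n * measure M (fibre I I) \<le> 1" for n
  proof -
    obtain C where C: "finite C" "card C = n" "C \<subseteq> carrier (R Quot I)"
      using infinite_arbitrarily_large[OF inf] by blast
    show ?thesis
      using measure_Union_fibre[OF I C(1,3)] bounded_measure C(2) measure_space_haar by metis
  qed
  then have "measure M (fibre I I) = 0"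
    using measure_nonneg by (intro real_archimedian_rdiv_eq_0[of _ 1]) auto
  then show False using measure_fibre_nonzero[OF I] by simp
qed

lemma measure_fibre:
  assumes I: "I \<in> nonzero_ideals R" and c: "c \<in> carrier (R Quot I)"
  shows "measure M (fibre I c) = 1 / real (card (carrier (R Quot I)))"
proof -
  interpret finite_measure M by (rule finite_measure_haar)
  let ?Q = "carrier (R Quot I)"
  have "(\<Union>c\<in>?Q. fibre I c) = space M"
    using Dhat_in_Quot I by (auto simp: fibre_def space_haar)
  then have *: "real (card ?Q) * measure M (fibre I I) = 1"
    using measure_Union_fibre[OF I finite_Quot_haar[OF I]] measure_space_haar by simp
  then have "real (card ?Q) \<noteq> 0" by (metis mult_zero_left zero_neq_one)
  with * show ?thesis
    unfolding measure_fibre_const[OF I c] by (metis nonzero_eq_divide_eq mult.commute)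
qed

end

sublocale Dhat_haar \<subseteq> finite_quotient_domain
  by unfold_locales (rule finite_Quot_haar)

section \<open>Averages over residues and the limit\<close>

context Dhat_haar
begin

text \<open>The lift of a residue is picked independently of \<open>\<phi>\<close>, so the average
  is linear in \<open>\<phi>\<close> without any assumption. It is independent of the lifts when
  \<open>\<phi>\<close> factors through the residue modulo \<open>A\<close>.\<close>

definition coset_average ::
    "('a set \<Rightarrow> 'a set) set \<Rightarrow> 'a set \<Rightarrow> (('a set \<Rightarrow> 'a set) \<Rightarrow> complex) \<Rightarrow> complex" where
  "coset_average Z A \<phi> =
     (\<Sum>c\<in>(\<lambda>x. x A) ` Z. \<phi> (SOME x. x \<in> carrier (Dhat R) \<and> x A = c)) / of_nat (card ((\<lambda>x. x A) ` Z))"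

text \<open>Each residue class has mass 1 over the size of \<open>R Quot A\<close>. The density
  cancels that size, so every class that meets \<open>Z\<close> gets weight 1 over the number of
  such classes.\<close>

lemma integral_approx_measure:
  fixes \<phi> :: "('a set \<Rightarrow> 'a set) \<Rightarrow> complex"
  assumes Z: "Z \<subseteq> carrier (Dhat R)" and A: "A \<in> nonzero_ideals R"
    and \<phi>: "\<And>x y. \<lbrakk>x \<in> carrier (Dhat R); y \<in> carrier (Dhat R); x A = y A\<rbrakk> \<Longrightarrow> \<phi> x = \<phi> y"
  shows "integral\<^sup>L (approx_measure R M Z A) \<phi> = coset_average Z A \<phi>"
proof (cases "Z = {}")
  case True
  \<comment> \<open>For empty \<open>Z\<close> the null measure matches the convention that division
    by 0 gives 0.\<close>
  then show ?thesis by (simp add: approx_measure_def coset_average_def)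
next
  case False
  interpret finite_measure M by (rule finite_measure_haar)
  let ?Q = "carrier (R Quot A)" and ?Z = "(\<lambda>x. x A) ` Z"
  define v where "v c = \<phi> (SOME x. x \<in> carrier (Dhat R) \<and> x A = c)" for c
  define r where "r = real (card ?Q) / real (card ?Z)"
  define W where "W = {y \<in> carrier (Dhat R). y A \<in> ?Z}"
  \<comment> \<open>A simple function that agrees with \<open>\<phi>\<close> on the space and is
    visibly measurable.\<close>
  define g where "g x = (\<Sum>c\<in>?Q. indicator (fibre A c) x *\<^sub>R v c)" for x
  have finQ: "finite ?Q" using A by (rule finite_Quot)
  have ZQ: "?Z \<subseteq> ?Q" using Z Dhat_in_Quot A by auto
  have finZ: "finite ?Z" using ZQ finQ by (rule finite_subset)
  have cards: "real (card ?Q) \<noteq> 0" "real (card ?Z) \<noteq> 0"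
    using finZ finQ ZQ False by (auto simp: card_eq_0_iff)
  have v: "v (x A) = \<phi> x" if "x \<in> carrier (Dhat R)" for x
  proof -
    have "(SOME y. y \<in> carrier (Dhat R) \<and> y A = x A) \<in> carrier (Dhat R) \<and>
        (SOME y. y \<in> carrier (Dhat R) \<and> y A = x A) A = x A"
      by (rule someI[of _ x]) (use that in simp)
    then show ?thesis unfolding v_def using that by (intro \<phi>) auto
  qed
  have ind: "(\<Sum>c\<in>C. indicator (fibre A c) x *\<^sub>R u c) = (if x A \<in> C then u (x A) else 0)"
    if "x \<in> carrier (Dhat R)" "finite C" for x C and u :: "'a set \<Rightarrow> complex"
  proof -
    have "(\<Sum>c\<in>C. indicator (fibre A c) x *\<^sub>R u c) = (\<Sum>c\<in>C. if c = x A then u c else 0)"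
      using that by (intro sum.cong) (auto simp: fibre_def indicator_def)
    then show ?thesis using that by simp
  qed
  have g: "g x = \<phi> x" if "x \<in> carrier (Dhat R)" for x
    using ind[OF that finQ, of v] Dhat_in_Quot[OF that A] v[OF that] by (simp add: g_def)
  have W: "W = (\<Union>c\<in>?Z. fibre A c)"
    by (auto simp: W_def fibre_def)
  have Wm: "W \<in> sets M"
    unfolding W by (intro sets.finite_UN finZ fibre_in_sets[OF A])
  have gm: "g \<in> borel_measurable M"
    unfolding g_def using fibre_in_sets[OF A] by (intro borel_measurable_sum borel_measurable_scaleR) auto
  have "approx_measure R M Z A = density M (\<lambda>x. ennreal r * indicator W x)"
    using False by (simp only: approx_measure_def if_False r_def W_def)
  moreover have "ennreal r * indicator W x = ennreal (r * indicator W x)" for x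
    by (simp add: indicator_def)
  ultimately have "approx_measure R M Z A = density M (\<lambda>x. ennreal (r * indicator W x))"
    by simp
  then have "integral\<^sup>L (approx_measure R M Z A) \<phi> = integral\<^sup>L (density M (\<lambda>x. ennreal (r * indicator W x))) \<phi>"
    by simp
  also have "\<dots> = integral\<^sup>L (density M (\<lambda>x. ennreal (r * indicator W x))) g"
    by (rule Bochner_Integration.integral_cong) (simp_all add: g space_haar)
  also have "\<dots> = integral\<^sup>L M (\<lambda>x. (r * indicator W x) *\<^sub>R g x)"
    using gm Wm by (intro integral_density) (auto simp: r_def)
  also have "\<dots> = integral\<^sup>L M (\<lambda>x. \<Sum>c\<in>?Z. indicator (fibre A c) x *\<^sub>R (r *\<^sub>R v c))"
  proof (rule Bochner_Integration.integral_cong[OF refl])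
    fix x assume "x \<in> space M"
    then have x: "x \<in> carrier (Dhat R)" by (simp add: space_haar)
    show "(r * indicator W x) *\<^sub>R g x = (\<Sum>c\<in>?Z. indicator (fibre A c) x *\<^sub>R (r *\<^sub>R v c))"
      unfolding ind[OF x finZ] g[OF x] using v[OF x] x by (simp add: W_def indicator_def)
  qed
  also have "\<dots> = (\<Sum>c\<in>?Z. integral\<^sup>L M (\<lambda>x. indicator (fibre A c) x *\<^sub>R (r *\<^sub>R v c)))"
    using fibre_in_sets[OF A]
    by (intro Bochner_Integration.integral_sum Bochner_Integration.integrable_scaleR_left integrable_real_indicator) (auto simp: emeasure_eq_measure)
  also have "\<dots> = (\<Sum>c\<in>?Z. measure M (fibre A c) *\<^sub>R (r *\<^sub>R v c))"
  proof (rule sum.cong[OF refl])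
    fix c
    have "integrable M (indicator (fibre A c) :: _ \<Rightarrow> real)"
      using fibre_in_sets[OF A] by (intro integrable_real_indicator) (auto simp: emeasure_eq_measure)
    then have "integral\<^sup>L M (\<lambda>x. indicator (fibre A c) x *\<^sub>R (r *\<^sub>R v c)) =
        integral\<^sup>L M (indicator (fibre A c)) *\<^sub>R (r *\<^sub>R v c)"
      by (intro Bochner_Integration.integral_scaleR_left)
    also have "integral\<^sup>L M (indicator (fibre A c) :: _ \<Rightarrow> real) = measure M (fibre A c)"
      using fibre_in_sets[OF A, of c] sets.sets_into_space[OF fibre_in_sets[OF A, of c]]
      by (simp add: Int_absorb2)
    finally show "integral\<^sup>L M (\<lambda>x. indicator (fibre A c) x *\<^sub>R (r *\<^sub>R v c)) =
        measure M (fibre A c) *\<^sub>R (r *\<^sub>R v c)" .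
  qed
  also have "\<dots> = (\<Sum>c\<in>?Z. v c / of_nat (card ?Z))"
  proof (rule sum.cong[OF refl])
    fix c assume "c \<in> ?Z"
    then have "measure M (fibre A c) * r = 1 / real (card ?Z)"
      using measure_fibre[OF A, of c] ZQ cards by (auto simp: r_def)
    then have "measure M (fibre A c) *\<^sub>R (r *\<^sub>R v c) = (1 / real (card ?Z)) *\<^sub>R v c"
      by (simp add: scaleR_scaleR)
    then show "measure M (fibre A c) *\<^sub>R (r *\<^sub>R v c) = v c / of_nat (card ?Z)"
      by (simp add: scaleR_conv_of_real)
  qed
  also have "\<dots> = coset_average Z A \<phi>"
    by (simp add: coset_average_def v_def sum_divide_distrib)
  finally show ?thesis .
qed

text \<open>Averages survive reduction along equinumerous fibres. The lifts chosen at the levels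
  \<open>A\<close> and \<open>E\<close> may differ, but they agree modulo \<open>E\<close>, which is
  all that \<open>\<phi>\<close> sees.\<close>

lemma coset_average_eq:
  assumes Z: "Z \<subseteq> carrier (Dhat R)" and E: "E \<in> nonzero_ideals R" and A: "A \<in> nonzero_ideals R" "A \<subseteq> E"
    and card_eq: "\<forall>c\<in>(\<lambda>x. x E) ` Z. \<forall>d\<in>(\<lambda>x. x E) ` Z.
       card {u \<in> (\<lambda>x. x A) ` Z. E <+> u = c} = card {u \<in> (\<lambda>x. x A) ` Z. E <+> u = d}"
    and \<phi>: "\<And>x y. \<lbrakk>x \<in> carrier (Dhat R); y \<in> carrier (Dhat R); x E = y E\<rbrakk> \<Longrightarrow> \<phi> x = \<phi> y"
  shows "coset_average Z A \<phi> = coset_average Z E \<phi>"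
proof -
  let ?ZA = "(\<lambda>x. x A) ` Z" and ?ZE = "(\<lambda>x. x E) ` Z"
  let ?rep = "\<lambda>B c. SOME x. x \<in> carrier (Dhat R) \<and> x B = c"
  have rep: "?rep B (z B) \<in> carrier (Dhat R) \<and> ?rep B (z B) B = z B" if "z \<in> carrier (Dhat R)" for B z
    by (rule someI[of _ z]) (use that in simp)
  have comp: "E <+> z A = z E" if "z \<in> Z" for z
    using Dhat_compat[of z A E] that Z E A by auto
  have im: "(\<lambda>u. E <+> u) ` ?ZA = ?ZE"
    using comp by (force simp: image_image)
  have finA: "finite ?ZA"
    by (rule finite_subset[OF _ finite_Quot[OF A(1)]]) (use Z A Dhat_in_Quot in auto)
  have eq: "\<phi> (?rep A u) = \<phi> (?rep E (E <+> u))" if "u \<in> ?ZA" for u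
  proof -
    obtain z where z: "z \<in> Z" "u = z A" using \<open>u \<in> ?ZA\<close> by auto
    then have zc: "z \<in> carrier (Dhat R)" using Z by auto
    have "?rep A u E = z E"
      using Dhat_eq_superset[of "?rep A (z A)" z A E] rep[OF zc, of A] zc z(2) A E by simp
    also have "\<dots> = ?rep E (z E) E"
      using rep[OF zc, of E] by simp
    finally show ?thesis
      using rep[OF zc, of A] rep[OF zc, of E] comp[OF z(1)] z(2) by (intro \<phi>) auto
  qed
  have "(\<Sum>u\<in>?ZA. \<phi> (?rep A u)) = (\<Sum>u\<in>?ZA. \<phi> (?rep E (E <+> u)))"
    by (rule sum.cong[OF refl eq])
  moreover have "(\<Sum>u\<in>?ZA. \<phi> (?rep E (E <+> u))) / of_nat (card ?ZA) =
      (\<Sum>c\<in>(\<lambda>u. E <+> u) ` ?ZA. \<phi> (?rep E c)) / of_nat (card ((\<lambda>u. E <+> u) ` ?ZA))"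
    by (rule average_over_equal_fibres[OF finA]) (use card_eq im in auto)
  ultimately show ?thesis
    unfolding coset_average_def im by simp
qed

lemma coset_average_add:
  "coset_average Z A (\<lambda>x. \<phi> x + \<psi> x) = coset_average Z A \<phi> + coset_average Z A \<psi>"
  by (simp add: coset_average_def sum.distrib add_divide_distrib)

lemma coset_average_mult:
  "coset_average Z A (\<lambda>x. c * \<phi> x) = c * coset_average Z A \<phi>"
  by (simp add: coset_average_def sum_distrib_left)

text \<open>The net is ordered by divisibility while the fibre count speaks of inclusion; a multiple
  of \<open>E\<close> lies in \<open>E\<close>.\<close>

lemma eventually_ideals_to_zero:
  assumes E: "E \<in> nonzero_ideals R"
  shows "eventually (\<lambda>A. A \<in> nonzero_ideals R \<and> A \<subseteq> E) (ideals_to_zero R)"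
proof -
  have "A \<subseteq> E" if A: "E divides\<^bsub>ideals_set R\<^esub> A" for A
  proof -
    obtain C where "ideal C R" "A = E \<cdot> C"
      using A by (auto simp: factor_def ideals_set_def)
    then show ?thesis
      using ideal_prod_inter[OF nonzero_idealD[OF E], of C] by auto
  qed
  then show ?thesis
    unfolding ideals_to_zero_def
    by (intro eventually_INF1[OF E]) (auto simp: eventually_principal)
qed

lemma indicator_test_function:
  assumes "openin (Dhat_topology R) U" "compactin (Dhat_topology R) U"
    "closedin (Dhat_topology R) U"
  shows "(indicator U :: _ \<Rightarrow> complex) \<in> test_functions (Dhat_topology R)"
  unfolding test_functions_def
proof (intro CollectI conjI ballI)
  let ?T = "Dhat_topology R"
  fix x assume x: "x \<in> topspace ?T"
  show "\<exists>V. openin ?T V \<and> x \<in> V \<and> (\<forall>y\<in>V. indicator U y = (indicator U x :: complex))"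
  proof (cases "x \<in> U")
    case True
    then show ?thesis using assms(1) by (intro exI[of _ U]) auto
  next
    case False
    then show ?thesis
      using assms(3) x by (intro exI[of _ "topspace ?T - U"]) (auto simp: closedin_def)
  qed
next
  show "\<exists>K. compactin (Dhat_topology R) K \<and> (\<forall>x. x \<notin> K \<longrightarrow> indicator U x = (0::complex))"
    using assms(2) by (intro exI[of _ U]) auto
qed

lemma procounting_distribution_exists:
  assumes Z: "Z \<subseteq> carrier (Dhat R)"
    and fib: "\<And>B. B \<in> nonzero_ideals R \<Longrightarrow> \<exists>E\<in>nonzero_ideals R. E \<subseteq> B \<and>
      (\<forall>A\<in>nonzero_ideals R. A \<subseteq> E \<longrightarrow>
        (\<forall>c\<in>(\<lambda>x. x E) ` Z. \<forall>d\<in>(\<lambda>x. x E) ` Z.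
          card {u \<in> (\<lambda>x. x A) ` Z. E <+> u = c} = card {u \<in> (\<lambda>x. x A) ` Z. E <+> u = d}))"
  shows "\<exists>\<mu>. is_procounting_distribution R M Z \<mu>"
proof -
  let ?T = "Dhat_topology R"
  define stable where "stable \<phi> E \<longleftrightarrow> E \<in> nonzero_ideals R \<and>
      (\<forall>A\<in>nonzero_ideals R. A \<subseteq> E \<longrightarrow> coset_average Z A \<phi> = coset_average Z E \<phi>)" for \<phi> E
  \<comment> \<open>The functional is total: without a stable ideal its value is arbitrary, but
    \<open>distribution\<close> constrains it on test functions only.\<close>
  define \<mu> where "\<mu> \<phi> = coset_average Z (SOME E. stable \<phi> E) \<phi>" for \<phi>
  have level: "\<exists>B\<in>nonzero_ideals R. \<forall>A\<in>nonzero_ideals R. A \<subseteq> B \<longrightarrow>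
      (\<forall>x\<in>carrier (Dhat R). \<forall>y\<in>carrier (Dhat R). x A = y A \<longrightarrow> \<phi> x = \<phi> y)"
    if \<phi>: "\<phi> \<in> test_functions ?T" for \<phi>
  proof -
    obtain B where B: "B \<in> nonzero_ideals R"
      "\<forall>x\<in>carrier (Dhat R). \<forall>y\<in>carrier (Dhat R). x B = y B \<longrightarrow> \<phi> x = \<phi> y"
      using Dhat_test_function_level[OF \<phi>] by blast
    show ?thesis
    proof (intro bexI[OF _ B(1)] ballI impI)
      fix A x y
      assume "A \<in> nonzero_ideals R" "A \<subseteq> B" "x \<in> carrier (Dhat R)" "y \<in> carrier (Dhat R)" "x A = y A"
      then show "\<phi> x = \<phi> y"
        using B Dhat_eq_superset[of x y A B] by blast
    qed
  qed
  have stable_ex: "\<exists>E. stable \<phi> E" if \<phi>: "\<phi> \<in> test_functions ?T" for \<phi>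
  proof -
    obtain B where B: "B \<in> nonzero_ideals R" "\<forall>A\<in>nonzero_ideals R. A \<subseteq> B \<longrightarrow>
        (\<forall>x\<in>carrier (Dhat R). \<forall>y\<in>carrier (Dhat R). x A = y A \<longrightarrow> \<phi> x = \<phi> y)"
      using level[OF \<phi>] by (rule bexE)
    obtain E where E: "E \<in> nonzero_ideals R" "E \<subseteq> B" "\<forall>A\<in>nonzero_ideals R. A \<subseteq> E \<longrightarrow>
        (\<forall>c\<in>(\<lambda>x. x E) ` Z. \<forall>d\<in>(\<lambda>x. x E) ` Z.
          card {u \<in> (\<lambda>x. x A) ` Z. E <+> u = c} = card {u \<in> (\<lambda>x. x A) ` Z. E <+> u = d})"
      using fib[OF B(1)] by (elim bexE conjE)
    have "coset_average Z A \<phi> = coset_average Z E \<phi>" if "A \<in> nonzero_ideals R" "A \<subseteq> E" for A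
      by (rule coset_average_eq[OF Z E(1) that E(3)[THEN bspec, OF that(1), THEN mp, OF that(2)] B(2)[rule_format, OF E(1,2)]])
    then show ?thesis
      using E(1) by (auto simp: stable_def)
  qed
  \<comment> \<open>Two stable ideals are compared through their intersection.\<close>
  have stable_eq: "coset_average Z E \<phi> = coset_average Z E' \<phi>" if "stable \<phi> E" "stable \<phi> E'" for \<phi> E E'
    using that nonzero_ideals_Int[of E E'] unfolding stable_def by (metis Int_lower1 Int_lower2)
  have \<mu>: "\<mu> \<phi> = coset_average Z E \<phi>" if "stable \<phi> E" for \<phi> E
    unfolding \<mu>_def using someI[of "stable \<phi>", OF that] that by (rule stable_eq)
  have "distribution ?T \<mu>"
    unfolding distribution_def
  proof (intro conjI ballI allI)
    fix \<phi> \<psi> assume "\<phi> \<in> test_functions ?T" "\<psi> \<in> test_functions ?T"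
    then obtain E E' where E: "stable \<phi> E" and E': "stable \<psi> E'" using stable_ex by blast
    have EE: "E \<inter> E' \<in> nonzero_ideals R"
      using E E' nonzero_ideals_Int unfolding stable_def by blast
    have 1: "stable \<phi> (E \<inter> E')" "stable \<psi> (E \<inter> E')"
      using E E' EE unfolding stable_def by (metis Int_lower1 Int_lower2 order_trans)+
    then have "stable (\<lambda>x. \<phi> x + \<psi> x) (E \<inter> E')"
      using EE unfolding stable_def coset_average_add by metis
    then show "\<mu> (\<lambda>x. \<phi> x + \<psi> x) = \<mu> \<phi> + \<mu> \<psi>"
      using \<mu> 1 by (simp add: coset_average_add)
  next
    fix c \<phi> assume "\<phi> \<in> test_functions ?T"
    then obtain E where E: "stable \<phi> E" using stable_ex by blast
    then have "stable (\<lambda>x. c * \<phi> x) E"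
      unfolding stable_def coset_average_mult by metis
    then show "\<mu> (\<lambda>x. c * \<phi> x) = c * \<mu> \<phi>"
      using \<mu> E by (simp add: coset_average_mult)
  qed
  moreover have "((\<lambda>A. integral\<^sup>L (approx_measure R M Z A) (indicator U :: _ \<Rightarrow> complex))
           \<longlongrightarrow> \<mu> (indicator U)) (ideals_to_zero R)"
    if U: "openin ?T U \<and> compactin ?T U" for U
  proof -
    have "closedin ?T U"
      using compactin_imp_closedin[OF Hausdorff_Dhat] U by blast
    then have \<phi>: "(indicator U :: _ \<Rightarrow> complex) \<in> test_functions ?T"
      using U indicator_test_function by blast
    obtain B where B: "B \<in> nonzero_ideals R" "\<forall>A\<in>nonzero_ideals R. A \<subseteq> B \<longrightarrow>
        (\<forall>x\<in>carrier (Dhat R). \<forall>y\<in>carrier (Dhat R). x A = y A \<longrightarrow>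
          indicator U x = (indicator U y :: complex))"
      using level[OF \<phi>] by (rule bexE)
    obtain E where E: "stable (indicator U :: _ \<Rightarrow> complex) E" using stable_ex[OF \<phi>] by blast
    have EN: "E \<in> nonzero_ideals R" using E by (simp add: stable_def)
    \<comment> \<open>Stability of \<open>E\<close> does not say that the indicator factors through
      the residue modulo \<open>A\<close>, as \<open>integral_approx_measure\<close> requires;
      intersecting with \<open>B\<close> provides this.\<close>
    have "eventually (\<lambda>A. A \<in> nonzero_ideals R \<and> A \<subseteq> E \<inter> B) (ideals_to_zero R)"
      by (rule eventually_ideals_to_zero[OF nonzero_ideals_Int[OF EN B(1)]])
    then have "eventually (\<lambda>A. integral\<^sup>L (approx_measure R M Z A) (indicator U) = \<mu> (indicator U)) (ideals_to_zero R)"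
    proof eventually_elim
      case (elim A)
      then have A: "A \<in> nonzero_ideals R" "A \<subseteq> E" "A \<subseteq> B" by auto
      have "integral\<^sup>L (approx_measure R M Z A) (indicator U) = coset_average Z A (indicator U)"
        by (rule integral_approx_measure[OF Z A(1) B(2)[rule_format, OF A(1,3)]])
      also have "\<dots> = coset_average Z E (indicator U)"
        using E[unfolded stable_def, THEN conjunct2, THEN bspec, OF A(1), THEN mp, OF A(2)] .
      finally show ?case unfolding \<mu>[OF E] .
    qed
    then show ?thesis by (rule tendsto_eventually)
  qed
  ultimately show ?thesis
    unfolding is_procounting_distribution_def by blast
qed

end

theorem proposition3p16:
  fixes F D :: "('a, 'm) ring_scheme"
    and S :: "('a \<Rightarrow> real) set set"
    and M :: "('a set \<Rightarrow> 'a set) measure"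
    and k :: nat
    and f :: "nat \<Rightarrow> nat \<Rightarrow> 'a"
    and Y :: "(nat \<Rightarrow> 'a set \<Rightarrow> 'a set) set"
  assumes "global_field F"
    and "S \<subseteq> places F" and "finite S" and "S \<noteq> {}" and "archimedean_places F \<subseteq> S"
    and "D = S_integers F S"
    and "normalized_haar_measure (Dhat D) (Dhat_topology D) M"
    and "\<And>i. i < k \<Longrightarrow> f i \<in> carrier (UP D)"
    and "Y \<subseteq> topspace (Dhat_power_topology D k)"
    and "openly_eulerian D k Y"
  shows "\<exists>\<mu>. is_procounting_distribution D M
           {a \<in> carrier (Dhat D). poly_map D k f a \<in> Dhat_closure D k Y} \<mu>"
proof -
  have "field F"
    using assms(1) by (auto simp: global_field_def number_field_def global_function_field_def)
  then have "domain D"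
    using S_integers_domain assms(5,6) by simp
  then interpret Dhat_haar D M
    using assms(7) by (simp add: Dhat_haar_def Dhat_haar_axioms_def)
  show ?thesis
    by (rule procounting_distribution_exists[OF _ poly_preimage_fibre_card[OF assms(8,10) refl]]) auto
qed

end
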